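(* Let $\mathcal{C}$ be a symmetric monoidal category in which every idempotent is a split idempotent. Let $A,C$ be bismall bicommutative Hopf monoids in $\mathcal{C}$ and let $B$ be an arbitrary bicommutative bimonoid in $\mathcal{C}$. If there exists an exact sequence $\mathds{1}\to A\to B\to C\to\mathds{1}$ of bicommutative Hopf monoids (so that, in particular, $B$ is a Hopf monoid), then $B$ is bismall.
   Context: Coherence isomorphisms are suppressed; $\mathds{1}$ is the unit object. An idempotent $p:X\to X$ (i.e. $p\circ p=p$) is split if there are an object $X^p$ and morphisms $\iota:X^p\to X$, $\pi:X\to X^p$ with $\pi\circ\iota=id_{X^p}$ and $\iota\circ\pi=p$. A bimonoid $A$ has structure maps $\nabla_A,\eta_A,\Delta_A,\epsilon_A$ (multiplication, unit, comultiplication, counit); a Hopf monoid is a bimonoid with an antipode; bicommutative means commutative and cocommutative. Morphisms of $\mathsf{Hopf}^{\mathsf{bc}}(\mathcal{C})$, the category of bicommutative Hopf monoids, are bimonoid homomorphisms, and $\mathds{1}$ is a zero object. Exactness of $\mathds{1}\to A\xrightarrow{\iota}B\xrightarrow{\pi}C\to\mathds{1}$ means that $\pi\circ\iota$ is trivial and that the induced homomorphisms $A\to Ker(\pi)$ and $Cok(\iota)\to C$ are isomorphisms, i.e. $\iota$ is a kernel of $\pi$ and $\pi$ is a cokernel of $\iota$ in $\mathsf{Hopf}^{\mathsf{bc}}(\mathcal{C})$ (kernels/cokernels being equalizers/coequalizers with the trivial homomorphism $\eta\circ\epsilon$). Actions. A left action $(A,\alpha,X)$ is a bimonoid $A$,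 an object $X$ and a morphism $\alpha:A\otimes X\to X$ which is associative and unital; the trivial action is $\epsilon_A\otimes id_X$. Its stabilized object $\alpha\backslash X$ is a coequalizer of $\alpha$ and $\epsilon_A\otimes id_X$. Its invariant object is a morphism $i:\alpha\backslash\backslash X\to X$ with $\alpha\circ(id_A\otimes i)=\epsilon_A\otimes i$, universal with this property. Let ${}_\alpha\gamma:\alpha\backslash\backslash X\to X\to\alpha\backslash X$ be the canonical composite. Right actions are treated in the same way. Dually, for a left coaction $\beta:Y\to A\otimes Y$ of a bimonoid $A$ (coassociative, counital), the stabilized object $\beta/Y\to Y$ is an equalizer of $\beta$ and the trivial coaction $\eta_A\otimes id_Y$, the invariant object is a universal morphism $q:Y\to\beta//Y$ with $(id_A\otimes q)\circ\beta=\eta_A\otimes q$, and ${}^\beta\gamma:\beta/Y\to Y\to\beta//Y$ is the canonical composite; similarly for right coactions. Bismall. A bimonoid $A$ is small if for every left action and every right action of $A$ the invariant and stabilized objects exist and the canonical morphism from the invariant to the stabilized object is an isomorphism. It is cosmall if for every left coaction and every right coaction of $A$ the invariant and stabilized objects exist and the canonical morphism from the stabilized to the invariant object is an isomorphism. Bismall means small and cosmall. *)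

theory Defs
  imports Main
begin

section \<open>Symmetric monoidal categories\<close>

record ('o, 'm) category =
  Obj :: "'o set"
  Arr :: "'m set"
  Dom :: "'m \<Rightarrow> 'o"
  Cod :: "'m \<Rightarrow> 'o"
  ident :: "'o \<Rightarrow> 'm"  ("\<i>\<index>")
  comp :: "'m \<Rightarrow> 'm \<Rightarrow> 'm"  (infixr "\<cdot>\<index>" 55)

text \<open>
  The coherence isomorphisms are part of the structure; the category is not assumed to be strict.
  The two tensor symbols separate the action on objects from the action on morphisms.
\<close>

record ('o, 'm) sm_category = "('o, 'm) category" +
  unit_obj :: "'o"  ("\<one>\<index>")
  tensor_obj :: "'o \<Rightarrow> 'o \<Rightarrow> 'o"  (infixr "\<odot>\<index>" 70)
  tensor_arr :: "'m \<Rightarrow> 'm \<Rightarrow> 'm"  (infixr "\<otimes>\<index>" 70)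
  associator :: "'o \<Rightarrow> 'o \<Rightarrow> 'o \<Rightarrow> 'm"  ("\<a>\<index>")
  left_unitor :: "'o \<Rightarrow> 'm"  ("\<l>\<index>")
  right_unitor :: "'o \<Rightarrow> 'm"  ("\<r>\<index>")
  symmetry :: "'o \<Rightarrow> 'o \<Rightarrow> 'm"  ("\<s>\<index>")

definition Hom :: "('o, 'm, 'e) category_scheme \<Rightarrow> 'o \<Rightarrow> 'o \<Rightarrow> 'm set" where
  "Hom \<C> X Y = {f \<in> Arr \<C>. Dom \<C> f = X \<and> Cod \<C> f = Y}"

locale category =
  fixes \<C> :: "('o, 'm, 'e) category_scheme" (structure)
  assumes dom_obj: "f \<in> Arr \<C> \<Longrightarrow> Dom \<C> f \<in> Obj \<C>"
    and cod_obj: "f \<in> Arr \<C> \<Longrightarrow> Cod \<C> f \<in> Obj \<C>"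
    and ident_hom: "X \<in> Obj \<C> \<Longrightarrow> \<i> X \<in> Hom \<C> X X"
    and comp_hom: "\<lbrakk>f \<in> Hom \<C> X Y; g \<in> Hom \<C> Y Z\<rbrakk> \<Longrightarrow> g \<cdot> f \<in> Hom \<C> X Z"
    and comp_ident_left: "f \<in> Hom \<C> X Y \<Longrightarrow> \<i> Y \<cdot> f = f"
    and comp_ident_right: "f \<in> Hom \<C> X Y \<Longrightarrow> f \<cdot> \<i> X = f"
    and comp_assoc: "\<lbrakk>f \<in> Hom \<C> W X; g \<in> Hom \<C> X Y; h \<in> Hom \<C> Y Z\<rbrakk>
      \<Longrightarrow> (h \<cdot> g) \<cdot> f = h \<cdot> (g \<cdot> f)"

context
  fixes \<C> :: "('o, 'm, 'e) category_scheme" (structure)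
begin

definition inverse_arrows :: "'m \<Rightarrow> 'm \<Rightarrow> bool" where
  "inverse_arrows f g \<longleftrightarrow>
     f \<in> Arr \<C> \<and> g \<in> Hom \<C> (Cod \<C> f) (Dom \<C> f) \<and>
     g \<cdot> f = \<i> (Dom \<C> f) \<and> f \<cdot> g = \<i> (Cod \<C> f)"

definition iso :: "'m \<Rightarrow> bool" where
  "iso f \<longleftrightarrow> (\<exists>g. inverse_arrows f g)"

definition inverse_arrow :: "'m \<Rightarrow> 'm" where
  "inverse_arrow f = (THE g. inverse_arrows f g)"

definition equalizer :: "'m \<Rightarrow> 'm \<Rightarrow> 'm \<Rightarrow> bool" where
  "equalizer f g e \<longleftrightarrow>
     e \<in> Hom \<C> (Dom \<C> e) (Dom \<C> f) \<and> f \<cdot> e = g \<cdot> e \<and>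
     (\<forall>Z z. z \<in> Hom \<C> Z (Dom \<C> f) \<and> f \<cdot> z = g \<cdot> z \<longrightarrow>
        (\<exists>!u. u \<in> Hom \<C> Z (Dom \<C> e) \<and> e \<cdot> u = z))"

definition coequalizer :: "'m \<Rightarrow> 'm \<Rightarrow> 'm \<Rightarrow> bool" where
  "coequalizer f g q \<longleftrightarrow>
     q \<in> Hom \<C> (Cod \<C> f) (Cod \<C> q) \<and> q \<cdot> f = q \<cdot> g \<and>
     (\<forall>Z z. z \<in> Hom \<C> (Cod \<C> f) Z \<and> z \<cdot> f = z \<cdot> g \<longrightarrow>
        (\<exists>!u. u \<in> Hom \<C> (Cod \<C> q) Z \<and> u \<cdot> q = z))"

definition split_idempotent :: "'m \<Rightarrow> bool" where
  "split_idempotent p \<longleftrightarrow>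
     (\<exists>Y \<in> Obj \<C>. \<exists>\<iota> \<in> Hom \<C> Y (Dom \<C> p). \<exists>\<pi> \<in> Hom \<C> (Dom \<C> p) Y.
        \<pi> \<cdot> \<iota> = \<i> Y \<and> \<iota> \<cdot> \<pi> = p)"

definition idempotents_split :: bool where
  "idempotents_split \<longleftrightarrow>
     (\<forall>X \<in> Obj \<C>. \<forall>p \<in> Hom \<C> X X. p \<cdot> p = p \<longrightarrow> split_idempotent p)"

end

locale symmetric_monoidal_category = category \<C>
  for \<C> :: "('o, 'm, 'e) sm_category_scheme" (structure) +
  assumes unit_obj: "\<one> \<in> Obj \<C>"
    and tensor_obj: "\<lbrakk>X \<in> Obj \<C>; Y \<in> Obj \<C>\<rbrakk> \<Longrightarrow> X \<odot> Y \<in> Obj \<C>"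
    and tensor_hom: "\<lbrakk>f \<in> Hom \<C> X Y; g \<in> Hom \<C> X' Y'\<rbrakk>
      \<Longrightarrow> f \<otimes> g \<in> Hom \<C> (X \<odot> X') (Y \<odot> Y')"
    and tensor_ident: "\<lbrakk>X \<in> Obj \<C>; Y \<in> Obj \<C>\<rbrakk> \<Longrightarrow> \<i> X \<otimes> \<i> Y = \<i> (X \<odot> Y)"
    and tensor_comp:
      "\<lbrakk>f \<in> Hom \<C> X Y; g \<in> Hom \<C> Y Z; f' \<in> Hom \<C> X' Y'; g' \<in> Hom \<C> Y' Z'\<rbrakk>
      \<Longrightarrow> (g \<cdot> f) \<otimes> (g' \<cdot> f') = (g \<otimes> g') \<cdot> (f \<otimes> f')"
    and associator_hom: "\<lbrakk>X \<in> Obj \<C>; Y \<in> Obj \<C>; Z \<in> Obj \<C>\<rbrakk>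
      \<Longrightarrow> \<a> X Y Z \<in> Hom \<C> ((X \<odot> Y) \<odot> Z) (X \<odot> (Y \<odot> Z))"
    and associator_iso: "\<lbrakk>X \<in> Obj \<C>; Y \<in> Obj \<C>; Z \<in> Obj \<C>\<rbrakk> \<Longrightarrow> iso \<C> (\<a> X Y Z)"
    and associator_natural:
      "\<lbrakk>f \<in> Hom \<C> X X'; g \<in> Hom \<C> Y Y'; h \<in> Hom \<C> Z Z'\<rbrakk>
      \<Longrightarrow> \<a> X' Y' Z' \<cdot> ((f \<otimes> g) \<otimes> h) = (f \<otimes> (g \<otimes> h)) \<cdot> \<a> X Y Z"
    and left_unitor_hom: "X \<in> Obj \<C> \<Longrightarrow> \<l> X \<in> Hom \<C> (\<one> \<odot> X) X"
    and left_unitor_iso: "X \<in> Obj \<C> \<Longrightarrow> iso \<C> (\<l> X)"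
    and left_unitor_natural: "f \<in> Hom \<C> X Y \<Longrightarrow> \<l> Y \<cdot> (\<i> \<one> \<otimes> f) = f \<cdot> \<l> X"
    and right_unitor_hom: "X \<in> Obj \<C> \<Longrightarrow> \<r> X \<in> Hom \<C> (X \<odot> \<one>) X"
    and right_unitor_iso: "X \<in> Obj \<C> \<Longrightarrow> iso \<C> (\<r> X)"
    and right_unitor_natural: "f \<in> Hom \<C> X Y \<Longrightarrow> \<r> Y \<cdot> (f \<otimes> \<i> \<one>) = f \<cdot> \<r> X"
    and symmetry_hom: "\<lbrakk>X \<in> Obj \<C>; Y \<in> Obj \<C>\<rbrakk> \<Longrightarrow> \<s> X Y \<in> Hom \<C> (X \<odot> Y) (Y \<odot> X)"
    and symmetry_natural: "\<lbrakk>f \<in> Hom \<C> X X'; g \<in> Hom \<C> Y Y'\<rbrakk>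
      \<Longrightarrow> \<s> X' Y' \<cdot> (f \<otimes> g) = (g \<otimes> f) \<cdot> \<s> X Y"
    and symmetry_inverse: "\<lbrakk>X \<in> Obj \<C>; Y \<in> Obj \<C>\<rbrakk> \<Longrightarrow> \<s> Y X \<cdot> \<s> X Y = \<i> (X \<odot> Y)"
    and pentagon: "\<lbrakk>W \<in> Obj \<C>; X \<in> Obj \<C>; Y \<in> Obj \<C>; Z \<in> Obj \<C>\<rbrakk>
      \<Longrightarrow> (\<i> W \<otimes> \<a> X Y Z) \<cdot> \<a> W (X \<odot> Y) Z \<cdot> (\<a> W X Y \<otimes> \<i> Z)
        = \<a> W X (Y \<odot> Z) \<cdot> \<a> (W \<odot> X) Y Z"
    and triangle: "\<lbrakk>X \<in> Obj \<C>; Y \<in> Obj \<C>\<rbrakk>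
      \<Longrightarrow> (\<i> X \<otimes> \<l> Y) \<cdot> \<a> X \<one> Y = \<r> X \<otimes> \<i> Y"
    and hexagon: "\<lbrakk>X \<in> Obj \<C>; Y \<in> Obj \<C>; Z \<in> Obj \<C>\<rbrakk>
      \<Longrightarrow> \<a> Y Z X \<cdot> \<s> X (Y \<odot> Z) \<cdot> \<a> X Y Z
        = (\<i> Y \<otimes> \<s> X Z) \<cdot> \<a> Y X Z \<cdot> (\<s> X Y \<otimes> \<i> Z)"

text \<open>The canonical isomorphism $(W \otimes X) \otimes (Y \otimes Z) \to (W \otimes Y) \otimes (X \otimes Z)$.\<close>

definition middle_four :: "('o, 'm, 'e) sm_category_scheme \<Rightarrow> 'o \<Rightarrow> 'o \<Rightarrow> 'o \<Rightarrow> 'o \<Rightarrow> 'm" where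
  "middle_four \<C> W X Y Z =
     inverse_arrow \<C> (\<a>\<^bsub>\<C>\<^esub> W Y (X \<odot>\<^bsub>\<C>\<^esub> Z)) \<cdot>\<^bsub>\<C>\<^esub>
     (\<i>\<^bsub>\<C>\<^esub> W \<otimes>\<^bsub>\<C>\<^esub>
       (\<a>\<^bsub>\<C>\<^esub> Y X Z \<cdot>\<^bsub>\<C>\<^esub> (\<s>\<^bsub>\<C>\<^esub> X Y \<otimes>\<^bsub>\<C>\<^esub> \<i>\<^bsub>\<C>\<^esub> Z) \<cdot>\<^bsub>\<C>\<^esub> inverse_arrow \<C> (\<a>\<^bsub>\<C>\<^esub> X Y Z)))
     \<cdot>\<^bsub>\<C>\<^esub> \<a>\<^bsub>\<C>\<^esub> W X (Y \<odot>\<^bsub>\<C>\<^esub> Z)"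


section \<open>Bimonoids and Hopf monoids\<close>

record ('o, 'm) bimonoid =
  obj :: 'o
  mult :: 'm
  unit :: 'm
  comult :: 'm
  counit :: 'm

locale bimonoid = symmetric_monoidal_category \<C>
  for \<C> :: "('o, 'm, 'e) sm_category_scheme" (structure) +
  fixes A :: "('o, 'm) bimonoid"
  assumes obj: "obj A \<in> Obj \<C>"
    and mult_hom: "mult A \<in> Hom \<C> (obj A \<odot> obj A) (obj A)"
    and unit_hom: "unit A \<in> Hom \<C> \<one> (obj A)"
    and comult_hom: "comult A \<in> Hom \<C> (obj A) (obj A \<odot> obj A)"
    and counit_hom: "counit A \<in> Hom \<C> (obj A) \<one>"
    and mult_assoc: "mult A \<cdot> (mult A \<otimes> \<i> (obj A))
      = mult A \<cdot> (\<i> (obj A) \<otimes> mult A) \<cdot> \<a> (obj A) (obj A) (obj A)"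
    and mult_unit_left: "mult A \<cdot> (unit A \<otimes> \<i> (obj A)) = \<l> (obj A)"
    and mult_unit_right: "mult A \<cdot> (\<i> (obj A) \<otimes> unit A) = \<r> (obj A)"
    and comult_coassoc: "\<a> (obj A) (obj A) (obj A) \<cdot> (comult A \<otimes> \<i> (obj A)) \<cdot> comult A
      = (\<i> (obj A) \<otimes> comult A) \<cdot> comult A"
    and comult_counit_left: "\<l> (obj A) \<cdot> (counit A \<otimes> \<i> (obj A)) \<cdot> comult A = \<i> (obj A)"
    and comult_counit_right: "\<r> (obj A) \<cdot> (\<i> (obj A) \<otimes> counit A) \<cdot> comult A = \<i> (obj A)"
    and comult_mult: "comult A \<cdot> mult A
      = (mult A \<otimes> mult A) \<cdot> middle_four \<C> (obj A) (obj A) (obj A) (obj A)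
          \<cdot> (comult A \<otimes> comult A)"
    and comult_unit: "comult A \<cdot> unit A = (unit A \<otimes> unit A) \<cdot> inverse_arrow \<C> (\<l> \<one>)"
    and counit_mult: "counit A \<cdot> mult A = \<l> \<one> \<cdot> (counit A \<otimes> counit A)"
    and counit_unit: "counit A \<cdot> unit A = \<i> \<one>"

locale bicommutative_bimonoid = bimonoid +
  assumes mult_comm: "mult A \<cdot> \<s> (obj A) (obj A) = mult A"
    and comult_cocomm: "\<s> (obj A) (obj A) \<cdot> comult A = comult A"

locale bicommutative_hopf_monoid = bicommutative_bimonoid +
  assumes ex_antipode: "\<exists>S. S \<in> Hom \<C> (obj A) (obj A) \<and>
      mult A \<cdot> (S \<otimes> \<i> (obj A)) \<cdot> comult A = unit A \<cdot> counit A \<and>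
      mult A \<cdot> (\<i> (obj A) \<otimes> S) \<cdot> comult A = unit A \<cdot> counit A"

context
  fixes \<C> :: "('o, 'm, 'e) sm_category_scheme" (structure)
begin

definition bimonoid_hom :: "('o, 'm) bimonoid \<Rightarrow> ('o, 'm) bimonoid \<Rightarrow> 'm \<Rightarrow> bool" where
  "bimonoid_hom A B f \<longleftrightarrow>
     f \<in> Hom \<C> (obj A) (obj B) \<and>
     f \<cdot> mult A = mult B \<cdot> (f \<otimes> f) \<and>
     f \<cdot> unit A = unit B \<and>
     comult B \<cdot> f = (f \<otimes> f) \<cdot> comult A \<and>
     counit B \<cdot> f = counit A"

definition trivial_hom :: "('o, 'm) bimonoid \<Rightarrow> ('o, 'm) bimonoid \<Rightarrow> 'm" where
  "trivial_hom A B = unit B \<cdot> counit A"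

text \<open>
  Kernels and cokernels are taken in the category of bicommutative Hopf monoids; the test objects
  range over that category, not over the ambient category.
\<close>

definition hopf_kernel ::
  "('o, 'm) bimonoid \<Rightarrow> ('o, 'm) bimonoid \<Rightarrow> ('o, 'm) bimonoid \<Rightarrow> 'm \<Rightarrow> 'm \<Rightarrow> bool" where
  "hopf_kernel A B C \<iota> \<pi> \<longleftrightarrow>
     bimonoid_hom A B \<iota> \<and> \<pi> \<cdot> \<iota> = trivial_hom B C \<cdot> \<iota> \<and>
     (\<forall>D f. bicommutative_hopf_monoid \<C> D \<and> bimonoid_hom D B f \<and>
          \<pi> \<cdot> f = trivial_hom B C \<cdot> f \<longrightarrow>
        (\<exists>!u. bimonoid_hom D A u \<and> \<iota> \<cdot> u = f))"

definition hopf_cokernel ::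
  "('o, 'm) bimonoid \<Rightarrow> ('o, 'm) bimonoid \<Rightarrow> ('o, 'm) bimonoid \<Rightarrow> 'm \<Rightarrow> 'm \<Rightarrow> bool" where
  "hopf_cokernel A B C \<iota> \<pi> \<longleftrightarrow>
     bimonoid_hom B C \<pi> \<and> \<pi> \<cdot> \<iota> = \<pi> \<cdot> trivial_hom A B \<and>
     (\<forall>D f. bicommutative_hopf_monoid \<C> D \<and> bimonoid_hom B D f \<and>
          f \<cdot> \<iota> = f \<cdot> trivial_hom A B \<longrightarrow>
        (\<exists>!u. bimonoid_hom C D u \<and> u \<cdot> \<pi> = f))"

definition short_exact ::
  "('o, 'm) bimonoid \<Rightarrow> ('o, 'm) bimonoid \<Rightarrow> ('o, 'm) bimonoid \<Rightarrow> 'm \<Rightarrow> 'm \<Rightarrow> bool" where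
  "short_exact A B C \<iota> \<pi> \<longleftrightarrow>
     bicommutative_hopf_monoid \<C> A \<and> bicommutative_hopf_monoid \<C> B \<and>
     bicommutative_hopf_monoid \<C> C \<and>
     bimonoid_hom A B \<iota> \<and> bimonoid_hom B C \<pi> \<and> \<pi> \<cdot> \<iota> = trivial_hom A C \<and>
     hopf_kernel A B C \<iota> \<pi> \<and> hopf_cokernel A B C \<iota> \<pi>"


section \<open>Actions and coactions\<close>

definition left_action :: "('o, 'm) bimonoid \<Rightarrow> 'm \<Rightarrow> 'o \<Rightarrow> bool" where
  "left_action A \<alpha> X \<longleftrightarrow>
     X \<in> Obj \<C> \<and> \<alpha> \<in> Hom \<C> (obj A \<odot> X) X \<and>
     \<alpha> \<cdot> (mult A \<otimes> \<i> X) = \<alpha> \<cdot> (\<i> (obj A) \<otimes> \<alpha>) \<cdot> \<a> (obj A) (obj A) X \<and>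
     \<alpha> \<cdot> (unit A \<otimes> \<i> X) = \<l> X"

definition left_stabilized :: "('o, 'm) bimonoid \<Rightarrow> 'm \<Rightarrow> 'o \<Rightarrow> 'm \<Rightarrow> bool" where
  "left_stabilized A \<alpha> X q \<longleftrightarrow> coequalizer \<C> \<alpha> (\<l> X \<cdot> (counit A \<otimes> \<i> X)) q"

definition left_fixes :: "('o, 'm) bimonoid \<Rightarrow> 'm \<Rightarrow> 'o \<Rightarrow> 'm \<Rightarrow> bool" where
  "left_fixes A \<alpha> X z \<longleftrightarrow>
     z \<in> Hom \<C> (Dom \<C> z) X \<and> \<alpha> \<cdot> (\<i> (obj A) \<otimes> z) = \<l> X \<cdot> (counit A \<otimes> z)"

definition left_invariant :: "('o, 'm) bimonoid \<Rightarrow> 'm \<Rightarrow> 'o \<Rightarrow> 'm \<Rightarrow> bool" where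
  "left_invariant A \<alpha> X i \<longleftrightarrow> left_fixes A \<alpha> X i \<and>
     (\<forall>z. left_fixes A \<alpha> X z \<longrightarrow> (\<exists>!u. u \<in> Hom \<C> (Dom \<C> z) (Dom \<C> i) \<and> i \<cdot> u = z))"

definition right_action :: "('o, 'm) bimonoid \<Rightarrow> 'm \<Rightarrow> 'o \<Rightarrow> bool" where
  "right_action A \<alpha> X \<longleftrightarrow>
     X \<in> Obj \<C> \<and> \<alpha> \<in> Hom \<C> (X \<odot> obj A) X \<and>
     \<alpha> \<cdot> (\<alpha> \<otimes> \<i> (obj A)) = \<alpha> \<cdot> (\<i> X \<otimes> mult A) \<cdot> \<a> X (obj A) (obj A) \<and>
     \<alpha> \<cdot> (\<i> X \<otimes> unit A) = \<r> X"

definition right_stabilized :: "('o, 'm) bimonoid \<Rightarrow> 'm \<Rightarrow> 'o \<Rightarrow> 'm \<Rightarrow> bool" where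
  "right_stabilized A \<alpha> X q \<longleftrightarrow> coequalizer \<C> \<alpha> (\<r> X \<cdot> (\<i> X \<otimes> counit A)) q"

definition right_fixes :: "('o, 'm) bimonoid \<Rightarrow> 'm \<Rightarrow> 'o \<Rightarrow> 'm \<Rightarrow> bool" where
  "right_fixes A \<alpha> X z \<longleftrightarrow>
     z \<in> Hom \<C> (Dom \<C> z) X \<and> \<alpha> \<cdot> (z \<otimes> \<i> (obj A)) = \<r> X \<cdot> (z \<otimes> counit A)"

definition right_invariant :: "('o, 'm) bimonoid \<Rightarrow> 'm \<Rightarrow> 'o \<Rightarrow> 'm \<Rightarrow> bool" where
  "right_invariant A \<alpha> X i \<longleftrightarrow> right_fixes A \<alpha> X i \<and>
     (\<forall>z. right_fixes A \<alpha> X z \<longrightarrow> (\<exists>!u. u \<in> Hom \<C> (Dom \<C> z) (Dom \<C> i) \<and> i \<cdot> u = z))"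

definition left_coaction :: "('o, 'm) bimonoid \<Rightarrow> 'm \<Rightarrow> 'o \<Rightarrow> bool" where
  "left_coaction A \<beta> Y \<longleftrightarrow>
     Y \<in> Obj \<C> \<and> \<beta> \<in> Hom \<C> Y (obj A \<odot> Y) \<and>
     \<a> (obj A) (obj A) Y \<cdot> (comult A \<otimes> \<i> Y) \<cdot> \<beta> = (\<i> (obj A) \<otimes> \<beta>) \<cdot> \<beta> \<and>
     \<l> Y \<cdot> (counit A \<otimes> \<i> Y) \<cdot> \<beta> = \<i> Y"

definition left_costabilized :: "('o, 'm) bimonoid \<Rightarrow> 'm \<Rightarrow> 'o \<Rightarrow> 'm \<Rightarrow> bool" where
  "left_costabilized A \<beta> Y j \<longleftrightarrow>
     equalizer \<C> \<beta> ((unit A \<otimes> \<i> Y) \<cdot> inverse_arrow \<C> (\<l> Y)) j"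

definition left_cofixes :: "('o, 'm) bimonoid \<Rightarrow> 'm \<Rightarrow> 'o \<Rightarrow> 'm \<Rightarrow> bool" where
  "left_cofixes A \<beta> Y z \<longleftrightarrow>
     z \<in> Hom \<C> Y (Cod \<C> z) \<and>
     (\<i> (obj A) \<otimes> z) \<cdot> \<beta> = (unit A \<otimes> z) \<cdot> inverse_arrow \<C> (\<l> Y)"

definition left_coinvariant :: "('o, 'm) bimonoid \<Rightarrow> 'm \<Rightarrow> 'o \<Rightarrow> 'm \<Rightarrow> bool" where
  "left_coinvariant A \<beta> Y q \<longleftrightarrow> left_cofixes A \<beta> Y q \<and>
     (\<forall>z. left_cofixes A \<beta> Y z \<longrightarrow> (\<exists>!u. u \<in> Hom \<C> (Cod \<C> q) (Cod \<C> z) \<and> u \<cdot> q = z))"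

definition right_coaction :: "('o, 'm) bimonoid \<Rightarrow> 'm \<Rightarrow> 'o \<Rightarrow> bool" where
  "right_coaction A \<beta> Y \<longleftrightarrow>
     Y \<in> Obj \<C> \<and> \<beta> \<in> Hom \<C> Y (Y \<odot> obj A) \<and>
     \<a> Y (obj A) (obj A) \<cdot> (\<beta> \<otimes> \<i> (obj A)) \<cdot> \<beta> = (\<i> Y \<otimes> comult A) \<cdot> \<beta> \<and>
     \<r> Y \<cdot> (\<i> Y \<otimes> counit A) \<cdot> \<beta> = \<i> Y"

definition right_costabilized :: "('o, 'm) bimonoid \<Rightarrow> 'm \<Rightarrow> 'o \<Rightarrow> 'm \<Rightarrow> bool" where
  "right_costabilized A \<beta> Y j \<longleftrightarrow>
     equalizer \<C> \<beta> ((\<i> Y \<otimes> unit A) \<cdot> inverse_arrow \<C> (\<r> Y)) j"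

definition right_cofixes :: "('o, 'm) bimonoid \<Rightarrow> 'm \<Rightarrow> 'o \<Rightarrow> 'm \<Rightarrow> bool" where
  "right_cofixes A \<beta> Y z \<longleftrightarrow>
     z \<in> Hom \<C> Y (Cod \<C> z) \<and>
     (z \<otimes> \<i> (obj A)) \<cdot> \<beta> = (z \<otimes> unit A) \<cdot> inverse_arrow \<C> (\<r> Y)"

definition right_coinvariant :: "('o, 'm) bimonoid \<Rightarrow> 'm \<Rightarrow> 'o \<Rightarrow> 'm \<Rightarrow> bool" where
  "right_coinvariant A \<beta> Y q \<longleftrightarrow> right_cofixes A \<beta> Y q \<and>
     (\<forall>z. right_cofixes A \<beta> Y z \<longrightarrow> (\<exists>!u. u \<in> Hom \<C> (Cod \<C> q) (Cod \<C> z) \<and> u \<cdot> q = z))"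


section \<open>Bismall bimonoids\<close>

text \<open>
  The universal objects are unique only up to isomorphism; the canonical morphism is required to be
  invertible for every choice of them.
\<close>

definition small :: "('o, 'm) bimonoid \<Rightarrow> bool" where
  "small A \<longleftrightarrow>
     (\<forall>\<alpha> X. left_action A \<alpha> X \<longrightarrow>
        (\<exists>i. left_invariant A \<alpha> X i) \<and> (\<exists>q. left_stabilized A \<alpha> X q) \<and>
        (\<forall>i q. left_invariant A \<alpha> X i \<and> left_stabilized A \<alpha> X q \<longrightarrow> iso \<C> (q \<cdot> i))) \<and>
     (\<forall>\<alpha> X. right_action A \<alpha> X \<longrightarrow>
        (\<exists>i. right_invariant A \<alpha> X i) \<and> (\<exists>q. right_stabilized A \<alpha> X q) \<and>
        (\<forall>i q. right_invariant A \<alpha> X i \<and> right_stabilized A \<alpha> X q \<longrightarrow> iso \<C> (q \<cdot> i)))"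

definition cosmall :: "('o, 'm) bimonoid \<Rightarrow> bool" where
  "cosmall A \<longleftrightarrow>
     (\<forall>\<beta> Y. left_coaction A \<beta> Y \<longrightarrow>
        (\<exists>j. left_costabilized A \<beta> Y j) \<and> (\<exists>q. left_coinvariant A \<beta> Y q) \<and>
        (\<forall>j q. left_costabilized A \<beta> Y j \<and> left_coinvariant A \<beta> Y q \<longrightarrow> iso \<C> (q \<cdot> j))) \<and>
     (\<forall>\<beta> Y. right_coaction A \<beta> Y \<longrightarrow>
        (\<exists>j. right_costabilized A \<beta> Y j) \<and> (\<exists>q. right_coinvariant A \<beta> Y q) \<and>
        (\<forall>j q. right_costabilized A \<beta> Y j \<and> right_coinvariant A \<beta> Y q \<longrightarrow> iso \<C> (q \<cdot> j)))"

definition bismall :: "('o, 'm) bimonoid \<Rightarrow> bool" where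
  "bismall A \<longleftrightarrow> small A \<and> cosmall A"

end

end

theory Submission
  imports Defs
begin

text \<open>
  A normalized integral of a bimonoid \<open>A\<close> is a point \<open>\<sigma> : \<one> \<rightarrow> A\<close> with \<open>a \<sigma> = \<epsilon>(a) \<sigma>\<close> and
  \<open>\<epsilon>(\<sigma>) = 1\<close>; for the group algebra of a finite group of invertible order it is the mean of the
  group elements. When idempotents split, a bicommutative bimonoid is small exactly if it has one.
  Indeed acting by \<open>\<sigma>\<close> is an idempotent on every \<open>A\<close>-object, and its splitting is at once the
  invariant and the stabilized object (\<open>small_if_normalized_integral\<close>). Conversely, the stabilized
  object of the regular action of \<open>A\<close> on itself is \<open>\<epsilon> : A \<rightarrow> \<one>\<close>, so smallness provides an invariant
  point on which \<open>\<epsilon>\<close> is invertible (\<open>normalized_integral_if_small\<close>).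

  So it remains to build an integral of \<open>B\<close> from integrals \<open>\<sigma>\<close> of \<open>A\<close> and \<open>\<tau>\<close> of \<open>C\<close>. Multiplication by
  \<open>\<iota> \<sigma>\<close> is an idempotent \<open>e = s p\<close> of \<open>B\<close>. It is linear over \<open>B\<close> and
  satisfies \<open>(id \<otimes> e) \<Delta> e = (e \<otimes> e) \<Delta>\<close>, so the Hopf structure of \<open>B\<close> descends along \<open>p : B \<rightarrow> Q\<close>
  (locale \<open>hopf_quotient\<close>), and \<open>p \<iota>\<close> is trivial. The cokernel property of \<open>\<pi>\<close> then yields a
  homomorphism \<open>v : C \<rightarrow> Q\<close> with \<open>v \<pi> = p\<close>. As \<open>s\<close> is linear over \<open>B\<close> and preserves counits,
  \<open>s v \<tau>\<close> is a normalized integral of \<open>B\<close> (\<open>normalized_integral_extension\<close>).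

  Cosmallness is smallness in the opposite category, where bimonoids turn into their duals and the
  kernel \<open>\<iota>\<close> of \<open>\<pi>\<close> becomes a cokernel, so the same argument applies to the reversed sequence.
\<close>

section \<open>Arrow calculus\<close>

context category
begin

lemma in_Hom: "f \<in> Hom \<C> X Y \<longleftrightarrow> f \<in> Arr \<C> \<and> Dom \<C> f = X \<and> Cod \<C> f = Y"
  by (simp add: Hom_def)

lemma ident_arr [simp]:
  assumes "X \<in> Obj \<C>"
  shows "\<i> X \<in> Arr \<C>" "Dom \<C> (\<i> X) = X" "Cod \<C> (\<i> X) = X"
  using ident_hom[OF assms] by (simp_all add: in_Hom)

lemma comp_arr [simp]:
  assumes "g \<in> Arr \<C>" "f \<in> Arr \<C>" "Dom \<C> g = Cod \<C> f"
  shows "g \<cdot> f \<in> Arr \<C>" "Dom \<C> (g \<cdot> f) = Dom \<C> f" "Cod \<C> (g \<cdot> f) = Cod \<C> g"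
  using comp_hom[of f "Dom \<C> f" "Cod \<C> f" g "Cod \<C> g"] assms by (simp_all add: in_Hom)

declare dom_obj [simp] cod_obj [simp]

lemma ident_comp [simp]: "\<lbrakk>f \<in> Arr \<C>; Cod \<C> f = Y\<rbrakk> \<Longrightarrow> \<i> Y \<cdot> f = f"
  using comp_ident_left[of f "Dom \<C> f" Y] by (simp add: in_Hom)

lemma comp_ident [simp]: "\<lbrakk>f \<in> Arr \<C>; Dom \<C> f = X\<rbrakk> \<Longrightarrow> f \<cdot> \<i> X = f"
  using comp_ident_right[of f X "Cod \<C> f"] by (simp add: in_Hom)

lemma assoc_right [simp]:
  "\<lbrakk>f \<in> Arr \<C>; g \<in> Arr \<C>; h \<in> Arr \<C>; Dom \<C> g = Cod \<C> f; Dom \<C> h = Cod \<C> g\<rbrakk>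
    \<Longrightarrow> (h \<cdot> g) \<cdot> f = h \<cdot> (g \<cdot> f)"
  using comp_assoc[of f "Dom \<C> f" "Cod \<C> f" g "Cod \<C> g" h "Cod \<C> h"] by (simp add: in_Hom)

text \<open>
  Composites are kept in right-associated form, where \<open>h \<cdot> g\<close> is a visible subterm only at the very
  end. This turns an equation for \<open>h \<cdot> g\<close> into one that rewrites inside a longer composite.
\<close>

lemma comp_tail:
  assumes "h \<cdot> g = k" "g \<in> Arr \<C>" "h \<in> Arr \<C>" "Dom \<C> h = Cod \<C> g" "x \<in> Arr \<C>" "Cod \<C> x = Dom \<C> g"
  shows "h \<cdot> (g \<cdot> x) = k \<cdot> x"
  using assms assoc_right[of x g h] by simp

lemma inverse_arrows_unique:
  assumes "inverse_arrows \<C> f g" "inverse_arrows \<C> f h"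
  shows "g = h"
proof -
  have "g = g \<cdot> (f \<cdot> h)" using assms by (simp add: inverse_arrows_def in_Hom)
  also have "\<dots> = (g \<cdot> f) \<cdot> h"
    using assms by (intro assoc_right[symmetric]) (simp_all add: inverse_arrows_def in_Hom)
  also have "\<dots> = h" using assms by (simp add: inverse_arrows_def in_Hom)
  finally show ?thesis .
qed

lemma inverse_arrow_eq: "inverse_arrows \<C> f g \<Longrightarrow> inverse_arrow \<C> f = g"
  unfolding inverse_arrow_def using inverse_arrows_unique by blast

lemma iso_inverse:
  assumes "iso \<C> f"
  shows "inverse_arrows \<C> f (inverse_arrow \<C> f)"
  using assms inverse_arrow_eq unfolding iso_def by blast

lemma inverse_arrow_simps [simp]:
  assumes "iso \<C> f"
  shows "f \<in> Arr \<C>" "inverse_arrow \<C> f \<in> Arr \<C>"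
    "Dom \<C> (inverse_arrow \<C> f) = Cod \<C> f" "Cod \<C> (inverse_arrow \<C> f) = Dom \<C> f"
    "inverse_arrow \<C> f \<cdot> f = \<i> (Dom \<C> f)" "f \<cdot> inverse_arrow \<C> f = \<i> (Cod \<C> f)"
  using iso_inverse[OF assms] by (simp_all add: inverse_arrows_def in_Hom)

lemma inverse_arrow_cancel [simp]:
  assumes "iso \<C> f" "h \<in> Arr \<C>"
  shows "Cod \<C> h = Dom \<C> f \<Longrightarrow> inverse_arrow \<C> f \<cdot> (f \<cdot> h) = h"
    and "Cod \<C> h = Cod \<C> f \<Longrightarrow> f \<cdot> (inverse_arrow \<C> f \<cdot> h) = h"
  using assms by (simp_all add: comp_tail[where h="inverse_arrow \<C> f"] comp_tail[where h=f])

lemma inverse_arrows_sym: "inverse_arrows \<C> f g \<Longrightarrow> inverse_arrows \<C> g f"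
  by (auto simp: inverse_arrows_def in_Hom)

lemma iso_inverse_arrow [simp]:
  assumes "iso \<C> f"
  shows "iso \<C> (inverse_arrow \<C> f)" "inverse_arrow \<C> (inverse_arrow \<C> f) = f"
  using inverse_arrows_sym[OF iso_inverse[OF assms]] inverse_arrow_eq
  by (auto simp: iso_def)

lemma isoI:
  assumes "f \<in> Arr \<C>" "g \<in> Arr \<C>" "Dom \<C> g = Cod \<C> f" "Cod \<C> g = Dom \<C> f"
    "g \<cdot> f = \<i> (Dom \<C> f)" "f \<cdot> g = \<i> (Cod \<C> f)"
  shows "iso \<C> f" "inverse_arrow \<C> f = g"
proof -
  have "inverse_arrows \<C> f g" using assms by (simp add: inverse_arrows_def in_Hom)
  then show "iso \<C> f" "inverse_arrow \<C> f = g" using inverse_arrow_eq by (auto simp: iso_def)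
qed

lemma iso_cancel_right:
  assumes "f \<cdot> h = g \<cdot> h" "iso \<C> h" "f \<in> Arr \<C>" "g \<in> Arr \<C>" "Dom \<C> f = Cod \<C> h" "Dom \<C> g = Cod \<C> h"
  shows "f = g"
proof -
  have "(f \<cdot> h) \<cdot> inverse_arrow \<C> h = (g \<cdot> h) \<cdot> inverse_arrow \<C> h" using assms(1) by simp
  then show ?thesis using assms(2-) by simp
qed

lemma iso_cancel_left:
  assumes "h \<cdot> f = h \<cdot> g" "iso \<C> h" "f \<in> Arr \<C>" "g \<in> Arr \<C>" "Cod \<C> f = Dom \<C> h" "Cod \<C> g = Dom \<C> h"
  shows "f = g"
  by (metis assms inverse_arrow_cancel(1))

lemma iso_comp [simp]:
  assumes "iso \<C> f" "iso \<C> g" "Dom \<C> g = Cod \<C> f"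
  shows "iso \<C> (g \<cdot> f)" "inverse_arrow \<C> (g \<cdot> f) = inverse_arrow \<C> f \<cdot> inverse_arrow \<C> g"
proof -
  have 1: "(inverse_arrow \<C> f \<cdot> inverse_arrow \<C> g) \<cdot> (g \<cdot> f) = \<i> (Dom \<C> (g \<cdot> f))"
    using assms by simp
  have 2: "(g \<cdot> f) \<cdot> (inverse_arrow \<C> f \<cdot> inverse_arrow \<C> g) = \<i> (Cod \<C> (g \<cdot> f))"
    using assms(3) by (simp add: assms(1,2) assms(3)[symmetric])
  show "iso \<C> (g \<cdot> f)" "inverse_arrow \<C> (g \<cdot> f) = inverse_arrow \<C> f \<cdot> inverse_arrow \<C> g"
    by (rule isoI[OF _ _ _ _ 1 2]; use assms in simp)+
qed

lemma split_epi_cancel: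
  assumes "f \<cdot> p = g \<cdot> p" "p \<cdot> s = \<i> (Cod \<C> p)" "p \<in> Arr \<C>" "s \<in> Arr \<C>" "Dom \<C> p = Cod \<C> s"
    "f \<in> Arr \<C>" "g \<in> Arr \<C>" "Dom \<C> f = Cod \<C> p" "Dom \<C> g = Cod \<C> p"
  shows "f = g"
proof -
  have "(f \<cdot> p) \<cdot> s = (g \<cdot> p) \<cdot> s" using assms(1) by simp
  then show ?thesis using assms(2-) by simp
qed

end

section \<open>Coherence\<close>

context symmetric_monoidal_category
begin

abbreviation associator_inv ("\<a>\<^sup>-") where "\<a>\<^sup>- X Y Z \<equiv> inverse_arrow \<C> (\<a> X Y Z)"
abbreviation left_unitor_inv ("\<l>\<^sup>-") where "\<l>\<^sup>- X \<equiv> inverse_arrow \<C> (\<l> X)"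
abbreviation right_unitor_inv ("\<r>\<^sup>-") where "\<r>\<^sup>- X \<equiv> inverse_arrow \<C> (\<r> X)"

declare unit_obj [simp] tensor_obj [simp] tensor_ident [simp]
  associator_iso [simp] left_unitor_iso [simp] right_unitor_iso [simp]

lemma tensor_arr [simp]:
  assumes "f \<in> Arr \<C>" "g \<in> Arr \<C>"
  shows "f \<otimes> g \<in> Arr \<C>" "Dom \<C> (f \<otimes> g) = Dom \<C> f \<odot> Dom \<C> g" "Cod \<C> (f \<otimes> g) = Cod \<C> f \<odot> Cod \<C> g"
  using tensor_hom[of f "Dom \<C> f" "Cod \<C> f" g "Dom \<C> g" "Cod \<C> g"] assms by (simp_all add: in_Hom)

lemma structure_arr [simp]:
  assumes "X \<in> Obj \<C>"
  shows "Dom \<C> (\<l> X) = \<one> \<odot> X" "Cod \<C> (\<l> X) = X" "Dom \<C> (\<r> X) = X \<odot> \<one>" "Cod \<C> (\<r> X) = X"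
    "\<lbrakk>Y \<in> Obj \<C>; Z \<in> Obj \<C>\<rbrakk> \<Longrightarrow> Dom \<C> (\<a> X Y Z) = (X \<odot> Y) \<odot> Z"
    "\<lbrakk>Y \<in> Obj \<C>; Z \<in> Obj \<C>\<rbrakk> \<Longrightarrow> Cod \<C> (\<a> X Y Z) = X \<odot> Y \<odot> Z"
    "Y \<in> Obj \<C> \<Longrightarrow> Dom \<C> (\<s> X Y) = X \<odot> Y" "Y \<in> Obj \<C> \<Longrightarrow> Cod \<C> (\<s> X Y) = Y \<odot> X"
    "Y \<in> Obj \<C> \<Longrightarrow> \<s> X Y \<in> Arr \<C>"
  using left_unitor_hom right_unitor_hom associator_hom symmetry_hom assms by (simp_all add: in_Hom)

lemma interchange [simp]:
  assumes "f \<in> Arr \<C>" "g \<in> Arr \<C>" "f' \<in> Arr \<C>" "g' \<in> Arr \<C>" "Dom \<C> g = Cod \<C> f" "Dom \<C> g' = Cod \<C> f'"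
  shows "(g \<otimes> g') \<cdot> (f \<otimes> f') = (g \<cdot> f) \<otimes> (g' \<cdot> f')"
  using tensor_comp[of f "Dom \<C> f" "Cod \<C> f" g "Cod \<C> g" f' "Dom \<C> f'" "Cod \<C> f'" g' "Cod \<C> g'"] assms
  by (simp add: in_Hom)

lemma interchange_tail [simp]:
  assumes "f \<in> Arr \<C>" "g \<in> Arr \<C>" "f' \<in> Arr \<C>" "g' \<in> Arr \<C>" "Dom \<C> g = Cod \<C> f" "Dom \<C> g' = Cod \<C> f'"
    "h \<in> Arr \<C>" "Cod \<C> h = Dom \<C> f \<odot> Dom \<C> f'"
  shows "(g \<otimes> g') \<cdot> ((f \<otimes> f') \<cdot> h) = ((g \<cdot> f) \<otimes> (g' \<cdot> f')) \<cdot> h"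
  using assms by (simp add: comp_tail)

lemma symmetry_iso [simp]:
  assumes "X \<in> Obj \<C>" "Y \<in> Obj \<C>"
  shows "iso \<C> (\<s> X Y)" "inverse_arrow \<C> (\<s> X Y) = \<s> Y X"
  by (rule isoI[where g="\<s> Y X"]; use assms symmetry_inverse in simp)+

lemma iso_ident [simp]:
  assumes "X \<in> Obj \<C>"
  shows "iso \<C> (\<i> X)" "inverse_arrow \<C> (\<i> X) = \<i> X"
  by (rule isoI[where g="\<i> X"]; use assms in simp)+

lemma iso_tensor [simp]:
  assumes "iso \<C> f" "iso \<C> g"
  shows "iso \<C> (f \<otimes> g)" "inverse_arrow \<C> (f \<otimes> g) = inverse_arrow \<C> f \<otimes> inverse_arrow \<C> g"
  by (rule isoI[where g="inverse_arrow \<C> f \<otimes> inverse_arrow \<C> g"]; use assms in simp)+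

lemma assoc_nat:
  assumes "f \<in> Arr \<C>" "g \<in> Arr \<C>" "h \<in> Arr \<C>" "Cod \<C> f = X" "Cod \<C> g = Y" "Cod \<C> h = Z"
  shows "\<a> X Y Z \<cdot> ((f \<otimes> g) \<otimes> h) = (f \<otimes> (g \<otimes> h)) \<cdot> \<a> (Dom \<C> f) (Dom \<C> g) (Dom \<C> h)"
  using associator_natural[of f "Dom \<C> f" X g "Dom \<C> g" Y h "Dom \<C> h" Z] assms by (simp add: in_Hom)

lemma left_unitor_nat: "\<lbrakk>f \<in> Arr \<C>; Cod \<C> f = Y\<rbrakk> \<Longrightarrow> \<l> Y \<cdot> (\<i> \<one> \<otimes> f) = f \<cdot> \<l> (Dom \<C> f)"
  using left_unitor_natural[of f "Dom \<C> f" Y] by (simp add: in_Hom)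

lemma right_unitor_nat: "\<lbrakk>f \<in> Arr \<C>; Cod \<C> f = Y\<rbrakk> \<Longrightarrow> \<r> Y \<cdot> (f \<otimes> \<i> \<one>) = f \<cdot> \<r> (Dom \<C> f)"
  using right_unitor_natural[of f "Dom \<C> f" Y] by (simp add: in_Hom)

lemma symmetry_nat: "\<lbrakk>f \<in> Arr \<C>; g \<in> Arr \<C>; Cod \<C> f = X; Cod \<C> g = Y\<rbrakk>
    \<Longrightarrow> \<s> X Y \<cdot> (f \<otimes> g) = (g \<otimes> f) \<cdot> \<s> (Dom \<C> f) (Dom \<C> g)"
  using symmetry_natural[of f "Dom \<C> f" X g "Dom \<C> g" Y] by (simp add: in_Hom)

text \<open>
  The naturality of inverse structure isomorphisms comes from pasting inverses onto both sides of a
  naturality square.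
\<close>

lemma inverse_square:
  assumes "u \<cdot> f = g \<cdot> v" "iso \<C> u" "iso \<C> v" "f \<in> Arr \<C>" "g \<in> Arr \<C>" "Dom \<C> u = Cod \<C> f"
    "Cod \<C> v = Dom \<C> g" "Dom \<C> v = Dom \<C> f" "Cod \<C> u = Cod \<C> g"
  shows "inverse_arrow \<C> u \<cdot> g = f \<cdot> inverse_arrow \<C> v"
proof -
  have "inverse_arrow \<C> u \<cdot> g = inverse_arrow \<C> u \<cdot> ((g \<cdot> v) \<cdot> inverse_arrow \<C> v)"
    using assms(2-) by simp
  also have "\<dots> = inverse_arrow \<C> u \<cdot> ((u \<cdot> f) \<cdot> inverse_arrow \<C> v)" using assms(1) by simp
  also have "\<dots> = f \<cdot> inverse_arrow \<C> v" using assms(2-) by simp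
  finally show ?thesis .
qed

lemma assoc_inv_nat:
  assumes "f \<in> Arr \<C>" "g \<in> Arr \<C>" "h \<in> Arr \<C>" "Cod \<C> f = X" "Cod \<C> g = Y" "Cod \<C> h = Z"
  shows "\<a>\<^sup>- X Y Z \<cdot> (f \<otimes> (g \<otimes> h)) = ((f \<otimes> g) \<otimes> h) \<cdot> \<a>\<^sup>- (Dom \<C> f) (Dom \<C> g) (Dom \<C> h)"
  by (rule inverse_square[OF assoc_nat]) (use assms in auto)

lemma left_unitor_inv_nat:
  assumes "f \<in> Arr \<C>" "Cod \<C> f = Y"
  shows "\<l>\<^sup>- Y \<cdot> f = (\<i> \<one> \<otimes> f) \<cdot> \<l>\<^sup>- (Dom \<C> f)"
  by (rule inverse_square[OF left_unitor_nat]) (use assms in auto)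

lemma right_unitor_inv_nat:
  assumes "f \<in> Arr \<C>" "Cod \<C> f = Y"
  shows "\<r>\<^sup>- Y \<cdot> f = (f \<otimes> \<i> \<one>) \<cdot> \<r>\<^sup>- (Dom \<C> f)"
  by (rule inverse_square[OF right_unitor_nat]) (use assms in auto)

lemma tensor_unit_faithful_left:
  assumes "\<i> \<one> \<otimes> f = \<i> \<one> \<otimes> g" "f \<in> Arr \<C>" "g \<in> Arr \<C>" "Dom \<C> f = Dom \<C> g" "Cod \<C> f = Cod \<C> g"
  shows "f = g"
proof (rule iso_cancel_right[where h="\<l> (Dom \<C> f)"])
  show "f \<cdot> \<l> (Dom \<C> f) = g \<cdot> \<l> (Dom \<C> f)"
    using assms left_unitor_nat[of f] left_unitor_nat[of g] by simp
qed (use assms in simp_all)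

lemma tensor_unit_faithful_right:
  assumes "f \<otimes> \<i> \<one> = g \<otimes> \<i> \<one>" "f \<in> Arr \<C>" "g \<in> Arr \<C>" "Dom \<C> f = Dom \<C> g" "Cod \<C> f = Cod \<C> g"
  shows "f = g"
proof (rule iso_cancel_right[where h="\<r> (Dom \<C> f)"])
  show "f \<cdot> \<r> (Dom \<C> f) = g \<cdot> \<r> (Dom \<C> f)"
    using assms right_unitor_nat[of f] right_unitor_nat[of g] by simp
qed (use assms in simp_all)

text \<open>
  Kelly's argument: tensoring with the unit object on the left is faithful, and after doing so the two
  sides agree along the pentagon for \<open>\<one>, \<one>, X, Y\<close>, since the triangle axiom rewrites both
  of its boundary paths.
\<close>

lemma left_unitor_tensor:
  assumes "X \<in> Obj \<C>" "Y \<in> Obj \<C>"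
  shows "\<l> (X \<odot> Y) \<cdot> \<a> \<one> X Y = \<l> X \<otimes> \<i> Y"
proof (rule tensor_unit_faithful_left)
  let ?k = "\<a> \<one> (\<one> \<odot> X) Y \<cdot> (\<a> \<one> \<one> X \<otimes> \<i> Y)"
  note [simp] = assms
  show "\<i> \<one> \<otimes> (\<l> (X \<odot> Y) \<cdot> \<a> \<one> X Y) = \<i> \<one> \<otimes> (\<l> X \<otimes> \<i> Y)"
  proof (rule iso_cancel_right[where h="?k"])
    have "(\<i> \<one> \<otimes> (\<l> (X \<odot> Y) \<cdot> \<a> \<one> X Y)) \<cdot> ?k
        = (\<i> \<one> \<otimes> \<l> (X \<odot> Y)) \<cdot> ((\<i> \<one> \<otimes> \<a> \<one> X Y) \<cdot> ?k)" by simp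
    also have "\<dots> = (\<i> \<one> \<otimes> \<l> (X \<odot> Y)) \<cdot> \<a> \<one> \<one> (X \<odot> Y) \<cdot> \<a> (\<one> \<odot> \<one>) X Y"
      using pentagon[of \<one> \<one> X Y] by simp
    also have "\<dots> = (\<r> \<one> \<otimes> \<i> (X \<odot> Y)) \<cdot> \<a> (\<one> \<odot> \<one>) X Y"
      using comp_tail[OF triangle[of \<one> "X \<odot> Y"]] by simp
    also have "\<dots> = \<a> \<one> X Y \<cdot> ((\<r> \<one> \<otimes> \<i> X) \<otimes> \<i> Y)"
      using assoc_nat[of "\<r> \<one>" "\<i> X" "\<i> Y" \<one> X Y] by simp
    also have "\<dots> = \<a> \<one> X Y \<cdot> ((\<i> \<one> \<otimes> \<l> X) \<otimes> \<i> Y) \<cdot> (\<a> \<one> \<one> X \<otimes> \<i> Y)"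
      using triangle[of \<one> X] by simp
    also have "\<dots> = (\<a> \<one> X Y \<cdot> ((\<i> \<one> \<otimes> \<l> X) \<otimes> \<i> Y)) \<cdot> (\<a> \<one> \<one> X \<otimes> \<i> Y)"
      by simp
    also have "\<dots> = (\<i> \<one> \<otimes> (\<l> X \<otimes> \<i> Y)) \<cdot> ?k"
      unfolding assoc_nat[of "\<i> \<one>" "\<l> X" "\<i> Y" \<one> X Y, simplified] by simp
    finally show "(\<i> \<one> \<otimes> (\<l> (X \<odot> Y) \<cdot> \<a> \<one> X Y)) \<cdot> ?k = (\<i> \<one> \<otimes> (\<l> X \<otimes> \<i> Y)) \<cdot> ?k" .
  qed simp_all
qed (use assms in simp_all)

lemma left_unitor_inv_tensor:
  assumes "X \<in> Obj \<C>" "Y \<in> Obj \<C>"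
  shows "\<a>\<^sup>- \<one> X Y \<cdot> \<l>\<^sup>- (X \<odot> Y) = \<l>\<^sup>- X \<otimes> \<i> Y"
  using arg_cong[OF left_unitor_tensor[OF assms], of "inverse_arrow \<C>"] assms by simp

text \<open>
  Naturality of \<open>\<l>\<close> at its own component gives \<open>\<l> (\<one> \<odot> \<one>) = \<i> \<one> \<otimes> \<l> \<one>\<close>, after which the preceding
  identity and the triangle axiom express \<open>\<l> \<one> \<otimes> \<i> \<one>\<close> and \<open>\<r> \<one> \<otimes> \<i> \<one>\<close> by the same composite.
\<close>

lemma unitors_agree: "\<l> \<one> = \<r> \<one>"
proof (rule tensor_unit_faithful_right)
  have "\<l> \<one> \<cdot> \<l> (\<one> \<odot> \<one>) = \<l> \<one> \<cdot> (\<i> \<one> \<otimes> \<l> \<one>)" using left_unitor_nat[of "\<l> \<one>"] by simp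
  then have "\<l> (\<one> \<odot> \<one>) = \<i> \<one> \<otimes> \<l> \<one>" by (rule iso_cancel_left) simp_all
  then show "\<l> \<one> \<otimes> \<i> \<one> = \<r> \<one> \<otimes> \<i> \<one>"
    using left_unitor_tensor[of \<one> \<one>] triangle[of \<one> \<one>] by simp
qed simp_all

text \<open>
  The hexagon for \<open>X, \<one>, \<one>\<close>, followed by the left unitor, gives the equation up to the invertible
  factor \<open>\<s> X \<one>\<close> and a tensor factor \<open>\<i> \<one>\<close>, both of which cancel.
\<close>

lemma left_unitor_symmetry:
  assumes "X \<in> Obj \<C>"
  shows "\<l> X \<cdot> \<s> X \<one> = \<r> X"
proof (rule tensor_unit_faithful_right)
  note [simp] = assms
  have "\<s> X \<one> \<cdot> (\<r> X \<otimes> \<i> \<one>) = \<s> X \<one> \<cdot> (\<i> X \<otimes> \<l> \<one>) \<cdot> \<a> X \<one> \<one>"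
    using triangle[of X \<one>] by simp
  also have "\<dots> = (\<s> X \<one> \<cdot> (\<i> X \<otimes> \<l> \<one>)) \<cdot> \<a> X \<one> \<one>" by simp
  also have "\<dots> = (\<l> \<one> \<otimes> \<i> X) \<cdot> \<s> X (\<one> \<odot> \<one>) \<cdot> \<a> X \<one> \<one>"
    unfolding symmetry_nat[of "\<i> X" "\<l> \<one>" X \<one>, simplified] by simp
  also have "\<dots> = \<l> (\<one> \<odot> X) \<cdot> (\<a> \<one> \<one> X \<cdot> \<s> X (\<one> \<odot> \<one>) \<cdot> \<a> X \<one> \<one>)"
    unfolding left_unitor_tensor[of \<one> X, simplified, symmetric] by simp
  also have "\<dots> = \<l> (\<one> \<odot> X) \<cdot> (\<i> \<one> \<otimes> \<s> X \<one>) \<cdot> \<a> \<one> X \<one> \<cdot> (\<s> X \<one> \<otimes> \<i> \<one>)"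
    using hexagon[of X \<one> \<one>] by simp
  also have "\<dots> = (\<l> (\<one> \<odot> X) \<cdot> (\<i> \<one> \<otimes> \<s> X \<one>)) \<cdot> \<a> \<one> X \<one> \<cdot> (\<s> X \<one> \<otimes> \<i> \<one>)"
    by simp
  also have "\<dots> = \<s> X \<one> \<cdot> (\<l> (X \<odot> \<one>) \<cdot> \<a> \<one> X \<one>) \<cdot> (\<s> X \<one> \<otimes> \<i> \<one>)"
    unfolding left_unitor_nat[of "\<s> X \<one>" "\<one> \<odot> X", simplified] by simp
  also have "\<dots> = \<s> X \<one> \<cdot> ((\<l> X \<cdot> \<s> X \<one>) \<otimes> \<i> \<one>)"
    unfolding left_unitor_tensor[of X \<one>, simplified] by simp
  finally have "\<s> X \<one> \<cdot> ((\<l> X \<cdot> \<s> X \<one>) \<otimes> \<i> \<one>) = \<s> X \<one> \<cdot> (\<r> X \<otimes> \<i> \<one>)" by simp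
  then show "(\<l> X \<cdot> \<s> X \<one>) \<otimes> \<i> \<one> = \<r> X \<otimes> \<i> \<one>"
    by (rule iso_cancel_left) simp_all
qed (use assms in simp_all)

lemma right_unitor_symmetry:
  assumes "X \<in> Obj \<C>"
  shows "\<r> X \<cdot> \<s> \<one> X = \<l> X"
proof -
  have "\<r> X \<cdot> \<s> \<one> X = \<l> X \<cdot> \<s> X \<one> \<cdot> \<s> \<one> X"
    unfolding left_unitor_symmetry[OF assms, symmetric] using assms by simp
  then show ?thesis using assms symmetry_inverse[of \<one> X] by simp
qed

subsection \<open>The middle-four interchange\<close>

lemma middle_four_arr [simp]:
  assumes "W \<in> Obj \<C>" "X \<in> Obj \<C>" "Y \<in> Obj \<C>" "Z \<in> Obj \<C>"
  shows "middle_four \<C> W X Y Z \<in> Arr \<C>"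
    "Dom \<C> (middle_four \<C> W X Y Z) = (W \<odot> X) \<odot> (Y \<odot> Z)"
    "Cod \<C> (middle_four \<C> W X Y Z) = (W \<odot> Y) \<odot> (X \<odot> Z)"
  using assms by (simp_all add: middle_four_def)

lemma middle_four_nat:
  assumes [simp]: "w \<in> Arr \<C>" "x \<in> Arr \<C>" "y \<in> Arr \<C>" "z \<in> Arr \<C>"
    and [simp]: "Cod \<C> w = W" "Cod \<C> x = X" "Cod \<C> y = Y" "Cod \<C> z = Z"
  shows "middle_four \<C> W X Y Z \<cdot> ((w \<otimes> x) \<otimes> (y \<otimes> z))
    = ((w \<otimes> y) \<otimes> (x \<otimes> z)) \<cdot> middle_four \<C> (Dom \<C> w) (Dom \<C> x) (Dom \<C> y) (Dom \<C> z)"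
proof -
  have [simp]: "W \<in> Obj \<C>" "X \<in> Obj \<C>" "Y \<in> Obj \<C>" "Z \<in> Obj \<C>"
    using assms cod_obj by blast+
  let ?n = "\<lambda>X Y Z. \<a> Y X Z \<cdot> (\<s> X Y \<otimes> \<i> Z) \<cdot> \<a>\<^sup>- X Y Z"
  have n: "?n X Y Z \<cdot> (x \<otimes> (y \<otimes> z)) = (y \<otimes> (x \<otimes> z)) \<cdot> ?n (Dom \<C> x) (Dom \<C> y) (Dom \<C> z)"
  proof -
    have "?n X Y Z \<cdot> (x \<otimes> (y \<otimes> z)) = \<a> Y X Z \<cdot> (\<s> X Y \<otimes> \<i> Z) \<cdot> (\<a>\<^sup>- X Y Z \<cdot> (x \<otimes> (y \<otimes> z)))"
      by simp
    also have "\<dots> = \<a> Y X Z \<cdot> (((\<s> X Y \<cdot> (x \<otimes> y)) \<otimes> z) \<cdot> \<a>\<^sup>- (Dom \<C> x) (Dom \<C> y) (Dom \<C> z))"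
      unfolding assoc_inv_nat[of x y z X Y Z, simplified] by simp
    also have "\<dots> = (\<a> Y X Z \<cdot> ((y \<otimes> x) \<otimes> z))
        \<cdot> ((\<s> (Dom \<C> x) (Dom \<C> y) \<otimes> \<i> (Dom \<C> z)) \<cdot> \<a>\<^sup>- (Dom \<C> x) (Dom \<C> y) (Dom \<C> z))"
      unfolding symmetry_nat[of x y X Y, simplified] by simp
    also have "\<dots> = (y \<otimes> (x \<otimes> z)) \<cdot> ?n (Dom \<C> x) (Dom \<C> y) (Dom \<C> z)"
      unfolding assoc_nat[of y x z Y X Z, simplified] by simp
    finally show ?thesis .
  qed
  have "middle_four \<C> W X Y Z \<cdot> ((w \<otimes> x) \<otimes> (y \<otimes> z))
      = \<a>\<^sup>- W Y (X \<odot> Z) \<cdot> (\<i> W \<otimes> ?n X Y Z) \<cdot> (\<a> W X (Y \<odot> Z) \<cdot> ((w \<otimes> x) \<otimes> (y \<otimes> z)))"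
    unfolding middle_four_def by simp
  also have "\<dots> = \<a>\<^sup>- W Y (X \<odot> Z) \<cdot> (w \<otimes> (?n X Y Z \<cdot> (x \<otimes> (y \<otimes> z))))
      \<cdot> \<a> (Dom \<C> w) (Dom \<C> x) (Dom \<C> y \<odot> Dom \<C> z)"
    unfolding assoc_nat[of w x "y \<otimes> z" W X "Y \<odot> Z", simplified] by simp
  also have "\<dots> = (\<a>\<^sup>- W Y (X \<odot> Z) \<cdot> (w \<otimes> (y \<otimes> (x \<otimes> z))))
      \<cdot> (\<i> (Dom \<C> w) \<otimes> ?n (Dom \<C> x) (Dom \<C> y) (Dom \<C> z))
      \<cdot> \<a> (Dom \<C> w) (Dom \<C> x) (Dom \<C> y \<odot> Dom \<C> z)"
    unfolding n by simp
  also have "\<dots> = ((w \<otimes> y) \<otimes> (x \<otimes> z)) \<cdot> middle_four \<C> (Dom \<C> w) (Dom \<C> x) (Dom \<C> y) (Dom \<C> z)"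
    unfolding assoc_inv_nat[of w y "x \<otimes> z" W Y "X \<odot> Z", simplified] middle_four_def by simp
  finally show ?thesis .
qed

text \<open>
  When the second factor is the unit object, the interchange moves nothing of substance and reduces to
  reassociation. This is the one coherence identity for \<open>middle_four\<close> behind the computation of
  \<open>\<Delta>(\<sigma> b)\<close> in \<open>average_comult_action\<close>.
\<close>

lemma middle_four_unit:
  assumes [simp]: "W \<in> Obj \<C>" "X \<in> Obj \<C>" "Y \<in> Obj \<C>"
  shows "(\<i> (W \<odot> X) \<otimes> \<l> Y) \<cdot> middle_four \<C> W \<one> X Y = \<a>\<^sup>- W X Y \<cdot> (\<r> W \<otimes> \<i> (X \<odot> Y))"
proof -
  let ?n = "\<a> X \<one> Y \<cdot> (\<s> \<one> X \<otimes> \<i> Y) \<cdot> \<a>\<^sup>- \<one> X Y"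
  have "(\<i> X \<otimes> \<l> Y) \<cdot> ?n = ((\<i> X \<otimes> \<l> Y) \<cdot> \<a> X \<one> Y) \<cdot> (\<s> \<one> X \<otimes> \<i> Y) \<cdot> \<a>\<^sup>- \<one> X Y" by simp
  also have "\<dots> = (\<l> X \<otimes> \<i> Y) \<cdot> \<a>\<^sup>- \<one> X Y"
    unfolding triangle[of X Y, simplified] by (simp add: right_unitor_symmetry)
  also have "\<dots> = \<l> (X \<odot> Y)"
    unfolding left_unitor_tensor[of X Y, simplified, symmetric] by simp
  finally have n: "(\<i> X \<otimes> \<l> Y) \<cdot> ?n = \<l> (X \<odot> Y)" .
  have "(\<i> (W \<odot> X) \<otimes> \<l> Y) \<cdot> middle_four \<C> W \<one> X Y
      = (((\<i> W \<otimes> \<i> X) \<otimes> \<l> Y) \<cdot> \<a>\<^sup>- W X (\<one> \<odot> Y)) \<cdot> (\<i> W \<otimes> ?n) \<cdot> \<a> W \<one> (X \<odot> Y)"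
    unfolding middle_four_def by simp
  also have "\<dots> = \<a>\<^sup>- W X Y \<cdot> (\<i> W \<otimes> ((\<i> X \<otimes> \<l> Y) \<cdot> ?n)) \<cdot> \<a> W \<one> (X \<odot> Y)"
    using assoc_inv_nat[of "\<i> W" "\<i> X" "\<l> Y" W X Y, symmetric] by simp
  also have "\<dots> = \<a>\<^sup>- W X Y \<cdot> (\<r> W \<otimes> \<i> (X \<odot> Y))"
    unfolding n using triangle[of W "X \<odot> Y"] by simp
  finally show ?thesis .
qed

end



section \<open>Normalized integrals and smallness\<close>

definition normalized_integral ::
  "('o, 'm, 'e) sm_category_scheme \<Rightarrow> ('o, 'm) bimonoid \<Rightarrow> 'm \<Rightarrow> bool" where
  "normalized_integral \<C> A \<sigma> \<longleftrightarrow> \<sigma> \<in> Hom \<C> \<one>\<^bsub>\<C>\<^esub> (obj A) \<and>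
     mult A \<cdot>\<^bsub>\<C>\<^esub> (\<i>\<^bsub>\<C>\<^esub> (obj A) \<otimes>\<^bsub>\<C>\<^esub> \<sigma>) = \<sigma> \<cdot>\<^bsub>\<C>\<^esub> counit A \<cdot>\<^bsub>\<C>\<^esub> \<r>\<^bsub>\<C>\<^esub> (obj A) \<and>
     counit A \<cdot>\<^bsub>\<C>\<^esub> \<sigma> = \<i>\<^bsub>\<C>\<^esub> \<one>\<^bsub>\<C>\<^esub>"

context bimonoid
begin

declare obj [simp]

lemma structure_maps_arr [simp]:
  "mult A \<in> Arr \<C>" "Dom \<C> (mult A) = obj A \<odot> obj A" "Cod \<C> (mult A) = obj A"
  "unit A \<in> Arr \<C>" "Dom \<C> (unit A) = \<one>" "Cod \<C> (unit A) = obj A"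
  "comult A \<in> Arr \<C>" "Dom \<C> (comult A) = obj A" "Cod \<C> (comult A) = obj A \<odot> obj A"
  "counit A \<in> Arr \<C>" "Dom \<C> (counit A) = obj A" "Cod \<C> (counit A) = \<one>"
  using mult_hom unit_hom comult_hom counit_hom by (simp_all add: in_Hom)

end

context symmetric_monoidal_category
begin

lemma left_fixes_comp:
  assumes "left_fixes \<C> A \<alpha> X z" "w \<in> Arr \<C>" "Cod \<C> w = Dom \<C> z" "bimonoid \<C> A"
    "\<alpha> \<in> Hom \<C> (obj A \<odot> X) X" "X \<in> Obj \<C>"
  shows "left_fixes \<C> A \<alpha> X (z \<cdot> w)"
proof -
  interpret bimonoid \<C> A by fact
  have z [simp]: "z \<in> Arr \<C>" "Cod \<C> z = X" and [simp]: "\<alpha> \<in> Arr \<C>" "Dom \<C> \<alpha> = obj A \<odot> X"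
    and eq: "\<alpha> \<cdot> (\<i> (obj A) \<otimes> z) = \<l> X \<cdot> (counit A \<otimes> z)"
    using assms by (simp_all add: left_fixes_def in_Hom)
  note [simp] = assms(2,3,6)
  have "\<alpha> \<cdot> (\<i> (obj A) \<otimes> (z \<cdot> w)) = (\<alpha> \<cdot> (\<i> (obj A) \<otimes> z)) \<cdot> (\<i> (obj A) \<otimes> w)" by simp
  also have "\<dots> = \<l> X \<cdot> (counit A \<otimes> (z \<cdot> w))" unfolding eq by simp
  finally show ?thesis by (simp add: left_fixes_def in_Hom)
qed

lemma left_invariant_mono:
  assumes "left_invariant \<C> A \<alpha> X i" "bimonoid \<C> A" "\<alpha> \<in> Hom \<C> (obj A \<odot> X) X" "X \<in> Obj \<C>"
    "i \<cdot> u = i \<cdot> v" "u \<in> Arr \<C>" "v \<in> Arr \<C>" "Cod \<C> u = Dom \<C> i" "Cod \<C> v = Dom \<C> i" "Dom \<C> u = Dom \<C> v"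
  shows "u = v"
proof -
  have i: "left_fixes \<C> A \<alpha> X i" using assms(1) by (simp add: left_invariant_def)
  then have [simp]: "i \<in> Arr \<C>" by (simp add: left_fixes_def in_Hom)
  have "left_fixes \<C> A \<alpha> X (i \<cdot> u)" by (rule left_fixes_comp[OF i]) (use assms in auto)
  then have "\<exists>!w. w \<in> Hom \<C> (Dom \<C> (i \<cdot> u)) (Dom \<C> i) \<and> i \<cdot> w = i \<cdot> u"
    using assms(1) by (simp add: left_invariant_def)
  then show ?thesis using assms(5-) by (auto simp: in_Hom)
qed

lemma coequalizer_epi:
  assumes "coequalizer \<C> f g q" "u \<cdot> q = v \<cdot> q" "f \<in> Arr \<C>" "g \<in> Arr \<C>" "Cod \<C> g = Cod \<C> f"
    "u \<in> Arr \<C>" "v \<in> Arr \<C>" "Dom \<C> u = Cod \<C> q" "Dom \<C> v = Cod \<C> q" "Cod \<C> u = Cod \<C> v"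
  shows "u = v"
proof -
  have [simp]: "q \<in> Arr \<C>" "Dom \<C> q = Cod \<C> f" and q: "q \<cdot> f = q \<cdot> g"
    using assms(1) by (simp_all add: coequalizer_def in_Hom)
  have "(u \<cdot> q) \<cdot> f = (u \<cdot> q) \<cdot> g" using q assms(3-) by simp
  moreover have "u \<cdot> q \<in> Hom \<C> (Cod \<C> f) (Cod \<C> u)" using assms(6,8) by (simp add: in_Hom)
  ultimately have "\<exists>!w. w \<in> Hom \<C> (Cod \<C> q) (Cod \<C> u) \<and> w \<cdot> q = u \<cdot> q"
    using assms(1) unfolding coequalizer_def by blast
  then show ?thesis using assms(2,6-) by (auto simp: in_Hom)
qed

lemma coequalizer_comp_iso:
  assumes [simp]: "iso \<C> u" "f \<in> Arr \<C>" "g \<in> Arr \<C>" "Dom \<C> f = Cod \<C> u" "Dom \<C> g = Cod \<C> u" "Cod \<C> g = Cod \<C> f"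
  shows "coequalizer \<C> (f \<cdot> u) (g \<cdot> u) q \<longleftrightarrow> coequalizer \<C> f g q"
proof -
  have "z \<cdot> f \<cdot> u = z \<cdot> g \<cdot> u \<longleftrightarrow> z \<cdot> f = z \<cdot> g" if "z \<in> Hom \<C> (Cod \<C> f) Z" for z Z
  proof
    assume "z \<cdot> f \<cdot> u = z \<cdot> g \<cdot> u"
    then have "(z \<cdot> f) \<cdot> u = (z \<cdot> g) \<cdot> u" using that by (simp add: in_Hom)
    then show "z \<cdot> f = z \<cdot> g" by (rule iso_cancel_right) (use that in \<open>simp_all add: in_Hom\<close>)
  next
    assume "z \<cdot> f = z \<cdot> g"
    then have "(z \<cdot> f) \<cdot> u = (z \<cdot> g) \<cdot> u" by simp
    then show "z \<cdot> f \<cdot> u = z \<cdot> g \<cdot> u" using that by (simp add: in_Hom)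
  qed
  then show ?thesis by (simp add: coequalizer_def cong: conj_cong)
qed

text \<open>
  The inverse of the hexagon axiom, with the inverse symmetries rewritten as symmetries.
\<close>

lemma hexagon_left:
  assumes [simp]: "X \<in> Obj \<C>" "Y \<in> Obj \<C>" "Z \<in> Obj \<C>"
  shows "\<s> (X \<odot> Y) Z = \<a> Z X Y \<cdot> (\<s> X Z \<otimes> \<i> Y) \<cdot> \<a>\<^sup>- X Z Y \<cdot> (\<i> X \<otimes> \<s> Y Z) \<cdot> \<a> X Y Z"
proof -
  have "inverse_arrow \<C> (\<a> X Y Z \<cdot> \<s> Z (X \<odot> Y) \<cdot> \<a> Z X Y)
      = inverse_arrow \<C> ((\<i> X \<otimes> \<s> Z Y) \<cdot> \<a> X Z Y \<cdot> (\<s> Z X \<otimes> \<i> Y))"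
    using hexagon[of Z X Y] by simp
  then have eq: "\<a>\<^sup>- Z X Y \<cdot> \<s> (X \<odot> Y) Z \<cdot> \<a>\<^sup>- X Y Z
      = (\<s> X Z \<otimes> \<i> Y) \<cdot> \<a>\<^sup>- X Z Y \<cdot> (\<i> X \<otimes> \<s> Y Z)" by simp
  have "\<s> (X \<odot> Y) Z = \<a> Z X Y \<cdot> (\<a>\<^sup>- Z X Y \<cdot> \<s> (X \<odot> Y) Z \<cdot> \<a>\<^sup>- X Y Z) \<cdot> \<a> X Y Z" by simp
  then show ?thesis unfolding eq by simp
qed

end

text \<open>
  The operator \<open>x \<mapsto> \<sigma> x\<close> on an object with an action generalizes the averaging (Reynolds) operator of
  a finite group. It is a projection onto the fixed part that factors through the quotient by the action.
\<close>

locale averaging = bicommutative_bimonoid +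
  fixes \<sigma> \<alpha> X
  assumes integral: "normalized_integral \<C> A \<sigma>" and action: "left_action \<C> A \<alpha> X"
begin

definition average where "average = \<alpha> \<cdot> (\<sigma> \<otimes> \<i> X) \<cdot> \<l>\<^sup>- X"

abbreviation "trivial \<equiv> \<l> X \<cdot> (counit A \<otimes> \<i> X)"

lemma integral_arr [simp]: "\<sigma> \<in> Arr \<C>" "Dom \<C> \<sigma> = \<one>" "Cod \<C> \<sigma> = obj A"
  and counit_integral: "counit A \<cdot> \<sigma> = \<i> \<one>"
  and mult_integral: "mult A \<cdot> (\<i> (obj A) \<otimes> \<sigma>) = \<sigma> \<cdot> counit A \<cdot> \<r> (obj A)"
  using integral by (simp_all add: normalized_integral_def in_Hom)

lemma action_arr [simp]: "X \<in> Obj \<C>" "\<alpha> \<in> Arr \<C>" "Dom \<C> \<alpha> = obj A \<odot> X" "Cod \<C> \<alpha> = X"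
  and action_assoc: "\<alpha> \<cdot> (mult A \<otimes> \<i> X) = \<alpha> \<cdot> (\<i> (obj A) \<otimes> \<alpha>) \<cdot> \<a> (obj A) (obj A) X"
  and action_unit: "\<alpha> \<cdot> (unit A \<otimes> \<i> X) = \<l> X"
  using action by (simp_all add: left_action_def in_Hom)

lemma average_arr [simp]: "average \<in> Arr \<C>" "Dom \<C> average = X" "Cod \<C> average = X"
  by (simp_all add: average_def)

text \<open>
  Commutativity turns the left integral into a right one.
\<close>

lemma integral_mult: "mult A \<cdot> (\<sigma> \<otimes> \<i> (obj A)) = \<sigma> \<cdot> counit A \<cdot> \<l> (obj A)"
proof -
  have "mult A \<cdot> (\<sigma> \<otimes> \<i> (obj A)) = mult A \<cdot> (\<s> (obj A) (obj A) \<cdot> (\<sigma> \<otimes> \<i> (obj A)))"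
    using comp_tail[OF mult_comm, of "\<sigma> \<otimes> \<i> (obj A)"] by simp
  also have "\<dots> = (mult A \<cdot> (\<i> (obj A) \<otimes> \<sigma>)) \<cdot> \<s> \<one> (obj A)"
    using symmetry_nat[of \<sigma> "\<i> (obj A)" "obj A" "obj A"] by simp
  also have "\<dots> = \<sigma> \<cdot> counit A \<cdot> \<l> (obj A)"
    unfolding mult_integral by (simp add: right_unitor_symmetry)
  finally show ?thesis .
qed

lemma action_twice:
  assumes "f \<in> Arr \<C>" "Cod \<C> f = obj A \<odot> (obj A \<odot> X)"
  shows "\<alpha> \<cdot> (\<i> (obj A) \<otimes> \<alpha>) \<cdot> f = \<alpha> \<cdot> (mult A \<otimes> \<i> X) \<cdot> \<a>\<^sup>- (obj A) (obj A) X \<cdot> f"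
  using comp_tail[OF action_assoc, of "\<a>\<^sup>- (obj A) (obj A) X \<cdot> f"] assms by simp

text \<open>
  In element notation \<open>\<sigma> (a x) = (\<sigma> a) x = \<epsilon>(a) \<sigma> x\<close>.
\<close>

lemma average_coequalizes: "average \<cdot> \<alpha> = average \<cdot> trivial"
proof -
  have "average \<cdot> \<alpha> = \<alpha> \<cdot> (\<sigma> \<otimes> \<i> X) \<cdot> (\<l>\<^sup>- X \<cdot> \<alpha>)" by (simp add: average_def)
  also have "\<dots> = \<alpha> \<cdot> (\<i> (obj A) \<otimes> \<alpha>) \<cdot> (\<sigma> \<otimes> (\<i> (obj A) \<otimes> \<i> X)) \<cdot> \<l>\<^sup>- (obj A \<odot> X)"
    unfolding left_unitor_inv_nat[of \<alpha> X, simplified] by simp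
  also have "\<dots> = \<alpha> \<cdot> (mult A \<otimes> \<i> X) \<cdot> (\<a>\<^sup>- (obj A) (obj A) X \<cdot> (\<sigma> \<otimes> (\<i> (obj A) \<otimes> \<i> X))) \<cdot> \<l>\<^sup>- (obj A \<odot> X)"
    by (subst action_twice) simp_all
  also have "\<dots> = \<alpha> \<cdot> ((mult A \<cdot> (\<sigma> \<otimes> \<i> (obj A))) \<otimes> \<i> X) \<cdot> (\<a>\<^sup>- \<one> (obj A) X \<cdot> \<l>\<^sup>- (obj A \<odot> X))"
    by (subst assoc_inv_nat) simp_all
  also have "\<dots> = average \<cdot> trivial"
    unfolding integral_mult left_unitor_inv_tensor[OF obj action_arr(1)] by (simp add: average_def)
  finally show ?thesis .
qed

text \<open>
  In element notation \<open>a (\<sigma> x) = (a \<sigma>) x = \<epsilon>(a) \<sigma> x\<close>.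
\<close>

lemma average_fixed: "\<alpha> \<cdot> (\<i> (obj A) \<otimes> average) = average \<cdot> trivial"
proof -
  have tri: "\<a>\<^sup>- (obj A) \<one> X \<cdot> (\<i> (obj A) \<otimes> \<l>\<^sup>- X) = \<r>\<^sup>- (obj A) \<otimes> \<i> X"
    using arg_cong[OF triangle[of "obj A" X], of "inverse_arrow \<C>"] by simp
  have "\<alpha> \<cdot> (\<i> (obj A) \<otimes> average)
      = \<alpha> \<cdot> (\<i> (obj A) \<otimes> \<alpha>) \<cdot> (\<i> (obj A) \<otimes> (\<sigma> \<otimes> \<i> X)) \<cdot> (\<i> (obj A) \<otimes> \<l>\<^sup>- X)"
    by (simp add: average_def)
  also have "\<dots> = \<alpha> \<cdot> (mult A \<otimes> \<i> X) \<cdot> (\<a>\<^sup>- (obj A) (obj A) X \<cdot> (\<i> (obj A) \<otimes> (\<sigma> \<otimes> \<i> X)))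
      \<cdot> (\<i> (obj A) \<otimes> \<l>\<^sup>- X)"
    by (subst action_twice) simp_all
  also have "\<dots> = \<alpha> \<cdot> ((mult A \<cdot> (\<i> (obj A) \<otimes> \<sigma>)) \<otimes> \<i> X) \<cdot> (\<a>\<^sup>- (obj A) \<one> X \<cdot> (\<i> (obj A) \<otimes> \<l>\<^sup>- X))"
    by (subst assoc_inv_nat) simp_all
  also have "\<dots> = average \<cdot> trivial"
    unfolding mult_integral tri by (simp add: average_def)
  finally show ?thesis .
qed

text \<open>
  On \<open>f\<close> the action is trivial, so \<open>f (\<sigma> x) = \<epsilon>(\<sigma>) f x\<close>, and \<open>\<epsilon>(\<sigma>) = 1\<close> by
  normalization; the lemma after this one is the same computation for morphisms into \<open>X\<close>.
\<close>

lemma average_absorbs_right: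
  assumes "f \<in> Arr \<C>" "Dom \<C> f = X" "f \<cdot> \<alpha> = f \<cdot> trivial"
  shows "f \<cdot> average = f"
proof -
  note [simp] = assms(1,2)
  have "f \<cdot> average = (f \<cdot> \<alpha>) \<cdot> (\<sigma> \<otimes> \<i> X) \<cdot> \<l>\<^sup>- X" by (simp add: average_def)
  also have "\<dots> = f" unfolding assms(3) by (simp add: counit_integral)
  finally show ?thesis .
qed

lemma average_absorbs_left:
  assumes "left_fixes \<C> A \<alpha> X z"
  shows "average \<cdot> z = z"
proof -
  have [simp]: "z \<in> Arr \<C>" "Cod \<C> z = X" and eq: "\<alpha> \<cdot> (\<i> (obj A) \<otimes> z) = \<l> X \<cdot> (counit A \<otimes> z)"
    using assms by (simp_all add: left_fixes_def in_Hom)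
  have "average \<cdot> z = \<alpha> \<cdot> (\<sigma> \<otimes> \<i> X) \<cdot> (\<l>\<^sup>- X \<cdot> z)" by (simp add: average_def)
  also have "\<dots> = (\<alpha> \<cdot> (\<i> (obj A) \<otimes> z)) \<cdot> (\<sigma> \<otimes> \<i> (Dom \<C> z)) \<cdot> \<l>\<^sup>- (Dom \<C> z)"
    unfolding left_unitor_inv_nat[of z X, simplified] by simp
  also have "\<dots> = (\<l> X \<cdot> (\<i> \<one> \<otimes> z)) \<cdot> \<l>\<^sup>- (Dom \<C> z)"
    unfolding eq by (simp add: counit_integral)
  also have "\<dots> = z" by (subst left_unitor_nat) simp_all
  finally show ?thesis .
qed

lemma average_idem: "average \<cdot> average = average"
  by (rule average_absorbs_right) (simp_all add: average_coequalizes)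

lemma left_fixes_average: "left_fixes \<C> A \<alpha> X average"
proof -
  have "average \<cdot> trivial = (average \<cdot> \<l> X) \<cdot> (counit A \<otimes> \<i> X)" by simp
  also have "\<dots> = \<l> X \<cdot> (counit A \<otimes> average)"
    unfolding left_unitor_nat[of average X, simplified, symmetric] by simp
  finally show ?thesis using average_fixed by (simp add: left_fixes_def in_Hom)
qed

text \<open>
  Averaging is absorbed by exactly the morphisms into and out of \<open>X\<close> that the two universal properties
  test, so both halves of a splitting of it are universal.
\<close>

lemma ex_left_invariant_stabilized:
  assumes "idempotents_split \<C>"
  shows "\<exists>i. left_invariant \<C> A \<alpha> X i" "\<exists>q. left_stabilized \<C> A \<alpha> X q"
proof -
  obtain Y i q where Y [simp]: "Y \<in> Obj \<C>" and "i \<in> Hom \<C> Y X" "q \<in> Hom \<C> X Y"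
    and qi: "q \<cdot> i = \<i> Y" and iq: "i \<cdot> q = average"
    using assms average_idem unfolding idempotents_split_def split_idempotent_def
    by (metis average_arr action_arr(1) in_Hom)
  then have [simp]: "i \<in> Arr \<C>" "Dom \<C> i = Y" "Cod \<C> i = X" "q \<in> Arr \<C>" "Dom \<C> q = X" "Cod \<C> q = Y"
    by (simp_all add: in_Hom)
  have i: "average \<cdot> i = i" unfolding iq[symmetric] using qi by simp
  have q: "q \<cdot> average = q" unfolding iq[symmetric] using comp_tail[OF qi, of q] by simp
  have "left_fixes \<C> A \<alpha> X i"
    using left_fixes_comp[OF left_fixes_average, of i] bimonoid_axioms by (simp add: i in_Hom)
  moreover have "\<exists>!u. u \<in> Hom \<C> (Dom \<C> z) (Dom \<C> i) \<and> i \<cdot> u = z" if z: "left_fixes \<C> A \<alpha> X z" for z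
  proof (rule ex1I[where a="q \<cdot> z"])
    have [simp]: "z \<in> Arr \<C>" "Cod \<C> z = X" using z by (simp_all add: left_fixes_def in_Hom)
    show "q \<cdot> z \<in> Hom \<C> (Dom \<C> z) (Dom \<C> i) \<and> i \<cdot> (q \<cdot> z) = z"
      using comp_tail[OF iq, of z] average_absorbs_left[OF z] by (simp add: in_Hom)
    show "u = q \<cdot> z" if "u \<in> Hom \<C> (Dom \<C> z) (Dom \<C> i) \<and> i \<cdot> u = z" for u
      using that comp_tail[OF qi, of u] by (auto simp: in_Hom)
  qed
  ultimately show "\<exists>i. left_invariant \<C> A \<alpha> X i" unfolding left_invariant_def by blast
  have "q \<cdot> \<alpha> = q \<cdot> average \<cdot> \<alpha>" using comp_tail[OF q, of \<alpha>] by simp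
  also have "\<dots> = q \<cdot> trivial"
    unfolding average_coequalizes using comp_tail[OF q, of trivial] by simp
  finally have "q \<cdot> \<alpha> = q \<cdot> trivial" .
  moreover have "\<exists>!u. u \<in> Hom \<C> (Cod \<C> q) Z \<and> u \<cdot> q = z"
    if z: "z \<in> Hom \<C> X Z \<and> z \<cdot> \<alpha> = z \<cdot> trivial" for z Z
  proof (rule ex1I[where a="z \<cdot> i"])
    have [simp]: "z \<in> Arr \<C>" "Dom \<C> z = X" "Cod \<C> z = Z" using z by (simp_all add: in_Hom)
    show "z \<cdot> i \<in> Hom \<C> (Cod \<C> q) Z \<and> (z \<cdot> i) \<cdot> q = z"
      using average_absorbs_right[of z] z by (simp add: in_Hom iq)
    show "u = z \<cdot> i" if "u \<in> Hom \<C> (Cod \<C> q) Z \<and> u \<cdot> q = z" for u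
      using that qi by (auto simp: in_Hom)
  qed
  ultimately have "left_stabilized \<C> A \<alpha> X q"
    by (simp add: left_stabilized_def coequalizer_def in_Hom)
  then show "\<exists>q. left_stabilized \<C> A \<alpha> X q" ..
qed

text \<open>
  The averaging operator is itself a fixed morphism and coequalizes the two actions, so it factors as
  \<open>average = i \<cdot> g \<cdot> q\<close> through arbitrary universal \<open>i\<close> and \<open>q\<close>; this \<open>g\<close> inverts \<open>q \<cdot> i\<close>.
\<close>

lemma iso_invariant_stabilized:
  assumes i: "left_invariant \<C> A \<alpha> X i" and q: "left_stabilized \<C> A \<alpha> X q"
  shows "iso \<C> (q \<cdot> i)"
proof -
  have fixed: "left_fixes \<C> A \<alpha> X i" using i by (simp add: left_invariant_def)
  have coeq: "coequalizer \<C> \<alpha> trivial q" using q by (simp add: left_stabilized_def)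
  have [simp]: "i \<in> Arr \<C>" "Cod \<C> i = X" using fixed by (simp_all add: left_fixes_def in_Hom)
  have [simp]: "q \<in> Arr \<C>" "Dom \<C> q = X" and qc: "q \<cdot> \<alpha> = q \<cdot> trivial"
    using coeq by (simp_all add: coequalizer_def in_Hom)
  obtain n where "n \<in> Hom \<C> X (Dom \<C> i)" and n: "i \<cdot> n = average"
    using i left_fixes_average unfolding left_invariant_def by (metis average_arr(2))
  then have [simp]: "n \<in> Arr \<C>" "Dom \<C> n = X" "Cod \<C> n = Dom \<C> i" by (simp_all add: in_Hom)
  have mono: "u = v" if "i \<cdot> u = i \<cdot> v" "u \<in> Arr \<C>" "v \<in> Arr \<C>" "Cod \<C> u = Dom \<C> i"
    "Cod \<C> v = Dom \<C> i" "Dom \<C> u = Dom \<C> v" for u v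
    by (rule left_invariant_mono[OF i]) (use that bimonoid_axioms in \<open>auto simp: in_Hom\<close>)
  have "n \<cdot> \<alpha> = n \<cdot> trivial"
  proof (rule mono)
    show "i \<cdot> n \<cdot> \<alpha> = i \<cdot> n \<cdot> trivial"
      using comp_tail[OF n, of \<alpha>] comp_tail[OF n, of trivial] average_coequalizes by simp
  qed simp_all
  then obtain g where "g \<in> Hom \<C> (Cod \<C> q) (Dom \<C> i)" and g: "g \<cdot> q = n"
    using coeq unfolding coequalizer_def by (metis \<open>n \<in> Hom \<C> X (Dom \<C> i)\<close> action_arr(4))
  then have [simp]: "g \<in> Arr \<C>" "Dom \<C> g = Cod \<C> q" "Cod \<C> g = Dom \<C> i" by (simp_all add: in_Hom)
  have "g \<cdot> q \<cdot> i = \<i> (Dom \<C> i)"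
  proof (rule mono)
    show "i \<cdot> g \<cdot> q \<cdot> i = i \<cdot> \<i> (Dom \<C> i)"
      using comp_tail[OF g, of i] comp_tail[OF n, of i] average_absorbs_left[OF fixed] by simp
  qed simp_all
  moreover have "(q \<cdot> i) \<cdot> g = \<i> (Cod \<C> q)"
  proof (rule coequalizer_epi[OF coeq])
    show "((q \<cdot> i) \<cdot> g) \<cdot> q = \<i> (Cod \<C> q) \<cdot> q"
      using average_absorbs_right[of q] qc by (simp add: g n)
  qed simp_all
  ultimately show ?thesis by (intro isoI(1)[of "q \<cdot> i" g]) simp_all
qed

end

context bicommutative_bimonoid
begin

text \<open>
  Over a commutative monoid, \<open>a x := x a\<close> turns right actions into left ones. It does not change fixed
  morphisms or coequalizers, so the right-handed half of smallness reduces to the left-handed one.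
\<close>

lemma left_action_of_right_action:
  assumes "right_action \<C> A \<alpha> X"
  shows "left_action \<C> A (\<alpha> \<cdot> \<s> (obj A) X) X"
proof -
  let ?A = "obj A" and ?\<beta> = "\<alpha> \<cdot> \<s> (obj A) X"
  have [simp]: "X \<in> Obj \<C>" "\<alpha> \<in> Arr \<C>" "Dom \<C> \<alpha> = X \<odot> ?A" "Cod \<C> \<alpha> = X"
    and assoc: "\<alpha> \<cdot> (\<alpha> \<otimes> \<i> ?A) = \<alpha> \<cdot> (\<i> X \<otimes> mult A) \<cdot> \<a> X ?A ?A"
    and unit: "\<alpha> \<cdot> (\<i> X \<otimes> unit A) = \<r> X"
    using assms by (simp_all add: right_action_def in_Hom)
  have "?\<beta> \<cdot> (\<i> ?A \<otimes> ?\<beta>) \<cdot> \<a> ?A ?A X = \<alpha> \<cdot> (\<s> ?A X \<cdot> (\<i> ?A \<otimes> ?\<beta>)) \<cdot> \<a> ?A ?A X"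
    by simp
  also have "\<dots> = (\<alpha> \<cdot> (\<alpha> \<otimes> \<i> ?A)) \<cdot> (\<s> ?A X \<otimes> \<i> ?A) \<cdot> \<s> ?A (?A \<odot> X) \<cdot> \<a> ?A ?A X"
    by (subst symmetry_nat) simp_all
  also have "\<dots> = \<alpha> \<cdot> (\<i> X \<otimes> mult A) \<cdot> \<a> X ?A ?A \<cdot> (\<s> ?A X \<otimes> \<i> ?A) \<cdot> \<a>\<^sup>- ?A X ?A
      \<cdot> (\<a> ?A X ?A \<cdot> \<s> ?A (?A \<odot> X) \<cdot> \<a> ?A ?A X)"
    unfolding assoc by simp
  also have "\<dots> = \<alpha> \<cdot> (\<i> X \<otimes> mult A) \<cdot> (\<a> X ?A ?A \<cdot> (\<s> ?A X \<otimes> \<i> ?A) \<cdot> \<a>\<^sup>- ?A X ?A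
      \<cdot> (\<i> ?A \<otimes> \<s> ?A X) \<cdot> \<a> ?A ?A X) \<cdot> (\<s> ?A ?A \<otimes> \<i> X)"
    using hexagon[of ?A ?A X] by simp
  \<comment> \<open>The two factors from \<open>A\<close> arrive in reversed order, which commutativity undoes.\<close>
  also have "\<dots> = \<alpha> \<cdot> (\<i> X \<otimes> mult A) \<cdot> (\<s> (?A \<odot> ?A) X \<cdot> (\<s> ?A ?A \<otimes> \<i> X))"
    using hexagon_left[of ?A ?A X] by simp
  also have "\<dots> = \<alpha> \<cdot> (\<i> X \<otimes> mult A) \<cdot> \<s> (?A \<odot> ?A) X"
    by (subst symmetry_nat) (simp_all add: mult_comm)
  also have "\<dots> = ?\<beta> \<cdot> (mult A \<otimes> \<i> X)"
    using symmetry_nat[of "mult A" "\<i> X" ?A X] by simp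
  finally have "?\<beta> \<cdot> (mult A \<otimes> \<i> X) = ?\<beta> \<cdot> (\<i> ?A \<otimes> ?\<beta>) \<cdot> \<a> ?A ?A X" by simp
  moreover have "?\<beta> \<cdot> (unit A \<otimes> \<i> X) = \<l> X"
    using symmetry_nat[of "unit A" "\<i> X" ?A X] comp_tail[OF unit, of "\<s> \<one> X"]
    by (simp add: right_unitor_symmetry)
  ultimately show ?thesis by (simp add: left_action_def in_Hom)
qed

lemma right_fixes_iff:
  assumes "right_action \<C> A \<alpha> X"
  shows "right_fixes \<C> A \<alpha> X z \<longleftrightarrow> left_fixes \<C> A (\<alpha> \<cdot> \<s> (obj A) X) X z"
proof (cases "z \<in> Hom \<C> (Dom \<C> z) X")
  case True
  let ?A = "obj A"
  have [simp]: "X \<in> Obj \<C>" "\<alpha> \<in> Arr \<C>" "Dom \<C> \<alpha> = X \<odot> ?A" "Cod \<C> \<alpha> = X" "z \<in> Arr \<C>" "Cod \<C> z = X"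
    using assms True by (simp_all add: right_action_def in_Hom)
  have 1: "(\<alpha> \<cdot> \<s> ?A X) \<cdot> (\<i> ?A \<otimes> z) = (\<alpha> \<cdot> (z \<otimes> \<i> ?A)) \<cdot> \<s> ?A (Dom \<C> z)"
    using symmetry_nat[of "\<i> ?A" z ?A X] by simp
  have 2: "\<l> X \<cdot> (counit A \<otimes> z) = (\<r> X \<cdot> (z \<otimes> counit A)) \<cdot> \<s> ?A (Dom \<C> z)"
    using symmetry_nat[of "counit A" z \<one> X] right_unitor_symmetry[of X, symmetric] by simp
  have "f \<cdot> \<s> ?A (Dom \<C> z) = g \<cdot> \<s> ?A (Dom \<C> z) \<longleftrightarrow> f = g"
    if "f \<in> Arr \<C>" "g \<in> Arr \<C>" "Dom \<C> f = Dom \<C> z \<odot> ?A" "Dom \<C> g = Dom \<C> z \<odot> ?A" for f g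
    using iso_cancel_right[of f "\<s> ?A (Dom \<C> z)" g] that by auto
  then show ?thesis unfolding right_fixes_def left_fixes_def 1 2 by (simp del: assoc_right)
qed (simp add: right_fixes_def left_fixes_def)

lemma right_stabilized_iff:
  assumes "right_action \<C> A \<alpha> X"
  shows "right_stabilized \<C> A \<alpha> X q \<longleftrightarrow> left_stabilized \<C> A (\<alpha> \<cdot> \<s> (obj A) X) X q"
proof -
  have [simp]: "X \<in> Obj \<C>" "\<alpha> \<in> Arr \<C>" "Dom \<C> \<alpha> = X \<odot> obj A" "Cod \<C> \<alpha> = X"
    using assms by (simp_all add: right_action_def in_Hom)
  have "\<l> X \<cdot> (counit A \<otimes> \<i> X) = (\<r> X \<cdot> (\<i> X \<otimes> counit A)) \<cdot> \<s> (obj A) X"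
    using symmetry_nat[of "counit A" "\<i> X" \<one> X] right_unitor_symmetry[of X, symmetric] by simp
  then show ?thesis
    unfolding right_stabilized_def left_stabilized_def by (simp add: coequalizer_comp_iso del: assoc_right)
qed

lemma small_if_normalized_integral:
  assumes "idempotents_split \<C>" "normalized_integral \<C> A \<sigma>"
  shows "small \<C> A"
proof -
  have L: "(\<exists>i. left_invariant \<C> A \<alpha> X i) \<and> (\<exists>q. left_stabilized \<C> A \<alpha> X q) \<and>
      (\<forall>i q. left_invariant \<C> A \<alpha> X i \<and> left_stabilized \<C> A \<alpha> X q \<longrightarrow> iso \<C> (q \<cdot> i))"
    if "left_action \<C> A \<alpha> X" for \<alpha> X
  proof -
    interpret averaging \<C> A \<sigma> \<alpha> X by unfold_locales (fact assms(2), fact that)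
    show ?thesis using ex_left_invariant_stabilized[OF assms(1)] iso_invariant_stabilized by blast
  qed
  moreover have "(\<exists>i. right_invariant \<C> A \<alpha> X i) \<and> (\<exists>q. right_stabilized \<C> A \<alpha> X q) \<and>
      (\<forall>i q. right_invariant \<C> A \<alpha> X i \<and> right_stabilized \<C> A \<alpha> X q \<longrightarrow> iso \<C> (q \<cdot> i))"
    if "right_action \<C> A \<alpha> X" for \<alpha> X
  proof -
    have "right_invariant \<C> A \<alpha> X i \<longleftrightarrow> left_invariant \<C> A (\<alpha> \<cdot> \<s> (obj A) X) X i" for i
      unfolding right_invariant_def left_invariant_def right_fixes_iff[OF that] ..
    then show ?thesis
      using L[OF left_action_of_right_action[OF that]] right_stabilized_iff[OF that] by simp
  qed
  ultimately show ?thesis unfolding small_def by blast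
qed

end

context bimonoid
begin

lemma left_action_mult: "left_action \<C> A (mult A) (obj A)"
  by (simp add: left_action_def in_Hom mult_assoc mult_unit_left)

text \<open>
  A morphism \<open>z\<close> with \<open>z(a b) = \<epsilon>(a) z(b)\<close> satisfies \<open>z(a) = z(a 1) = \<epsilon>(a) z(1)\<close>, so it factors uniquely
  through the counit.
\<close>

lemma left_stabilized_mult: "left_stabilized \<C> A (mult A) (obj A) (counit A)"
proof -
  let ?A = "obj A"
  have "counit A \<cdot> mult A = (\<l> \<one> \<cdot> (\<i> \<one> \<otimes> counit A)) \<cdot> (counit A \<otimes> \<i> ?A)"
    by (simp add: counit_mult)
  also have "\<dots> = counit A \<cdot> \<l> ?A \<cdot> (counit A \<otimes> \<i> ?A)"
    by (subst left_unitor_nat) simp_all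
  finally have coeq: "counit A \<cdot> mult A = counit A \<cdot> \<l> ?A \<cdot> (counit A \<otimes> \<i> ?A)" .
  have "\<exists>!u. u \<in> Hom \<C> \<one> Z \<and> u \<cdot> counit A = z"
    if z: "z \<in> Hom \<C> ?A Z" "z \<cdot> mult A = z \<cdot> \<l> ?A \<cdot> (counit A \<otimes> \<i> ?A)" for z Z
  proof (rule ex1I[where a="z \<cdot> unit A"])
    have [simp]: "z \<in> Arr \<C>" "Dom \<C> z = ?A" "Cod \<C> z = Z" using z by (simp_all add: in_Hom)
    have "z = z \<cdot> (mult A \<cdot> (\<i> ?A \<otimes> unit A)) \<cdot> \<r>\<^sup>- ?A" by (simp add: mult_unit_right)
    also have "\<dots> = (z \<cdot> mult A) \<cdot> (\<i> ?A \<otimes> unit A) \<cdot> \<r>\<^sup>- ?A" by simp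
    also have "\<dots> = z \<cdot> (\<l> ?A \<cdot> (\<i> \<one> \<otimes> unit A)) \<cdot> (counit A \<otimes> \<i> \<one>) \<cdot> \<r>\<^sup>- ?A"
      unfolding z(2) by simp
    also have "\<dots> = z \<cdot> unit A \<cdot> (\<r> \<one> \<cdot> (counit A \<otimes> \<i> \<one>)) \<cdot> \<r>\<^sup>- ?A"
      by (subst left_unitor_nat) (simp_all add: unitors_agree)
    also have "\<dots> = z \<cdot> unit A \<cdot> counit A" by (subst right_unitor_nat) simp_all
    finally show "z \<cdot> unit A \<in> Hom \<C> \<one> Z \<and> (z \<cdot> unit A) \<cdot> counit A = z" by (simp add: in_Hom)
    show "u = z \<cdot> unit A" if "u \<in> Hom \<C> \<one> Z \<and> u \<cdot> counit A = z" for u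
      using that by (auto simp: in_Hom counit_unit)
  qed
  then show ?thesis using coeq by (auto simp: left_stabilized_def coequalizer_def in_Hom)
qed

text \<open>
  The invariant object \<open>i\<close> of the regular action is carried isomorphically onto \<open>\<one>\<close> by the counit; the
  integral is \<open>i\<close> precomposed with the inverse of that isomorphism.
\<close>

lemma normalized_integral_if_small:
  assumes "small \<C> A"
  shows "\<exists>\<sigma>. normalized_integral \<C> A \<sigma>"
proof -
  let ?A = "obj A"
  obtain i where i: "left_invariant \<C> A (mult A) ?A i"
    using assms left_action_mult unfolding small_def by blast
  then have isoi: "iso \<C> (counit A \<cdot> i)"
    using assms left_action_mult left_stabilized_mult unfolding small_def by blast
  let ?j = "inverse_arrow \<C> (counit A \<cdot> i)"
  have fixed: "left_fixes \<C> A (mult A) ?A i" using i by (simp add: left_invariant_def)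
  then have [simp]: "i \<in> Arr \<C>" "Cod \<C> i = ?A" by (simp_all add: left_fixes_def in_Hom)
  have [simp]: "?j \<in> Arr \<C>" "Dom \<C> ?j = \<one>" "Cod \<C> ?j = Dom \<C> i" using isoi by simp_all
  have "left_fixes \<C> A (mult A) ?A (i \<cdot> ?j)"
    using left_fixes_comp[OF fixed, of ?j] bimonoid_axioms by (simp add: in_Hom)
  then have "mult A \<cdot> (\<i> ?A \<otimes> (i \<cdot> ?j)) = \<l> ?A \<cdot> (counit A \<otimes> (i \<cdot> ?j))"
    by (simp add: left_fixes_def)
  also have "\<dots> = (\<l> ?A \<cdot> (\<i> \<one> \<otimes> (i \<cdot> ?j))) \<cdot> (counit A \<otimes> \<i> \<one>)" by simp
  also have "\<dots> = (i \<cdot> ?j) \<cdot> (\<r> \<one> \<cdot> (counit A \<otimes> \<i> \<one>))"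
    by (subst left_unitor_nat) (simp_all add: unitors_agree)
  also have "\<dots> = (i \<cdot> ?j) \<cdot> counit A \<cdot> \<r> ?A" by (subst right_unitor_nat) simp_all
  finally show ?thesis
    using inverse_arrow_simps(6)[OF isoi] by (auto simp: normalized_integral_def in_Hom intro!: exI[of _ "i \<cdot> ?j"])
qed

end


section \<open>Split quotients of Hopf monoids\<close>

text \<open>
  Every axiom for \<open>Q\<close>, precomposed with a tensor power of \<open>p\<close>, becomes the image under \<open>p\<close> of the same
  axiom for \<open>A\<close>. Tensor powers of \<open>p\<close> are again split epimorphisms and so can be cancelled, which
  would fail for epimorphisms in general.
\<close>

lemma (in bicommutative_bimonoid) bicommutative_bimonoid_split_epi:
  assumes hom: "bimonoid_hom \<C> A Q p" and s [simp]: "s \<in> Arr \<C>" "Dom \<C> s = obj Q" "Cod \<C> s = obj A"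
    and ps: "p \<cdot> s = \<i> (obj Q)"
    and Q: "obj Q \<in> Obj \<C>" "mult Q \<in> Hom \<C> (obj Q \<odot> obj Q) (obj Q)" "unit Q \<in> Hom \<C> \<one> (obj Q)"
      "comult Q \<in> Hom \<C> (obj Q) (obj Q \<odot> obj Q)" "counit Q \<in> Hom \<C> (obj Q) \<one>"
  shows "bicommutative_bimonoid \<C> Q"
proof -
  let ?A = "obj A" and ?Q = "obj Q"
  let ?p2 = "p \<otimes> p" and ?p3 = "(p \<otimes> p) \<otimes> p"
  have [simp]: "p \<in> Arr \<C>" "Dom \<C> p = ?A" "Cod \<C> p = ?Q"
    and hm: "mult Q \<cdot> (p \<otimes> p) = p \<cdot> mult A" and hu: "p \<cdot> unit A = unit Q"
    and hc: "comult Q \<cdot> p = (p \<otimes> p) \<cdot> comult A" and he: "counit Q \<cdot> p = counit A"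
    using hom by (simp_all add: bimonoid_hom_def in_Hom)
  have [simp]: "?Q \<in> Obj \<C>"
    "mult Q \<in> Arr \<C>" "Dom \<C> (mult Q) = ?Q \<odot> ?Q" "Cod \<C> (mult Q) = ?Q"
    "unit Q \<in> Arr \<C>" "Dom \<C> (unit Q) = \<one>" "Cod \<C> (unit Q) = ?Q"
    "comult Q \<in> Arr \<C>" "Dom \<C> (comult Q) = ?Q" "Cod \<C> (comult Q) = ?Q \<odot> ?Q"
    "counit Q \<in> Arr \<C>" "Dom \<C> (counit Q) = ?Q" "Cod \<C> (counit Q) = \<one>"
    using Q by (simp_all add: in_Hom)
  have epi1: "f = g" if "f \<cdot> p = g \<cdot> p" "f \<in> Arr \<C>" "g \<in> Arr \<C>" "Dom \<C> f = ?Q" "Dom \<C> g = ?Q" for f g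
    by (rule split_epi_cancel[of f p g s]) (use that ps in simp_all)
  have epi2: "f = g" if "f \<cdot> ?p2 = g \<cdot> ?p2" "f \<in> Arr \<C>" "g \<in> Arr \<C>" "Dom \<C> f = ?Q \<odot> ?Q"
    "Dom \<C> g = ?Q \<odot> ?Q" for f g
    by (rule split_epi_cancel[of f ?p2 g "s \<otimes> s"]) (use that ps in simp_all)
  have epi3: "f = g" if "f \<cdot> ?p3 = g \<cdot> ?p3" "f \<in> Arr \<C>" "g \<in> Arr \<C>" "Dom \<C> f = (?Q \<odot> ?Q) \<odot> ?Q"
    "Dom \<C> g = (?Q \<odot> ?Q) \<odot> ?Q" for f g
    by (rule split_epi_cancel[of f ?p3 g "(s \<otimes> s) \<otimes> s"]) (use that ps in simp_all)
  have epil: "f = g" if "f \<cdot> (\<i> \<one> \<otimes> p) = g \<cdot> (\<i> \<one> \<otimes> p)" "f \<in> Arr \<C>" "g \<in> Arr \<C>" "Dom \<C> f = \<one> \<odot> ?Q"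
    "Dom \<C> g = \<one> \<odot> ?Q" for f g
    by (rule split_epi_cancel[of f "\<i> \<one> \<otimes> p" g "\<i> \<one> \<otimes> s"]) (use that ps in simp_all)
  have epir: "f = g" if "f \<cdot> (p \<otimes> \<i> \<one>) = g \<cdot> (p \<otimes> \<i> \<one>)" "f \<in> Arr \<C>" "g \<in> Arr \<C>" "Dom \<C> f = ?Q \<odot> \<one>"
    "Dom \<C> g = ?Q \<odot> \<one>" for f g
    by (rule split_epi_cancel[of f "p \<otimes> \<i> \<one>" g "s \<otimes> \<i> \<one>"]) (use that ps in simp_all)
  have hm': "mult Q \<cdot> ((p \<cdot> f) \<otimes> (p \<cdot> g)) = p \<cdot> mult A \<cdot> (f \<otimes> g)"
    if "f \<in> Arr \<C>" "g \<in> Arr \<C>" "Cod \<C> f = ?A" "Cod \<C> g = ?A" for f g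
    using comp_tail[OF hm, of "f \<otimes> g"] that by simp
  have hc': "comult Q \<cdot> p \<cdot> f = (p \<otimes> p) \<cdot> comult A \<cdot> f" if "f \<in> Arr \<C>" "Cod \<C> f = ?A" for f
    using comp_tail[OF hc, of f] that by simp
  have he': "counit Q \<cdot> p \<cdot> f = counit A \<cdot> f" if "f \<in> Arr \<C>" "Cod \<C> f = ?A" for f
    using comp_tail[OF he, of f] that by simp
  have assoc: "mult Q \<cdot> (mult Q \<otimes> \<i> ?Q) = mult Q \<cdot> (\<i> ?Q \<otimes> mult Q) \<cdot> \<a> ?Q ?Q ?Q"
  proof (rule epi3)
    have "(mult Q \<cdot> (mult Q \<otimes> \<i> ?Q)) \<cdot> ?p3 = p \<cdot> mult A \<cdot> (mult A \<otimes> \<i> ?A)"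
      using hm'[of "mult A" "\<i> ?A"] by (simp add: hm)
    also have "\<dots> = mult Q \<cdot> (\<i> ?Q \<otimes> mult Q) \<cdot> (p \<otimes> (p \<otimes> p)) \<cdot> \<a> ?A ?A ?A"
      using comp_tail[OF hm, of "(\<i> ?A \<otimes> mult A) \<cdot> \<a> ?A ?A ?A"] by (simp add: mult_assoc hm)
    also have "\<dots> = (mult Q \<cdot> (\<i> ?Q \<otimes> mult Q) \<cdot> \<a> ?Q ?Q ?Q) \<cdot> ?p3"
      using assoc_nat[of p p p ?Q ?Q ?Q] by simp
    finally show "(mult Q \<cdot> (mult Q \<otimes> \<i> ?Q)) \<cdot> ?p3
      = (mult Q \<cdot> (\<i> ?Q \<otimes> mult Q) \<cdot> \<a> ?Q ?Q ?Q) \<cdot> ?p3" .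
  qed simp_all
  have unitl: "mult Q \<cdot> (unit Q \<otimes> \<i> ?Q) = \<l> ?Q"
  proof (rule epil)
    show "(mult Q \<cdot> (unit Q \<otimes> \<i> ?Q)) \<cdot> (\<i> \<one> \<otimes> p) = \<l> ?Q \<cdot> (\<i> \<one> \<otimes> p)"
      using hm'[of "unit A" "\<i> ?A"] left_unitor_nat[of p ?Q]
      by (simp add: hu[symmetric] mult_unit_left)
  qed simp_all
  have unitr: "mult Q \<cdot> (\<i> ?Q \<otimes> unit Q) = \<r> ?Q"
  proof (rule epir)
    show "(mult Q \<cdot> (\<i> ?Q \<otimes> unit Q)) \<cdot> (p \<otimes> \<i> \<one>) = \<r> ?Q \<cdot> (p \<otimes> \<i> \<one>)"
      using hm'[of "\<i> ?A" "unit A"] right_unitor_nat[of p ?Q]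
      by (simp add: hu[symmetric] mult_unit_right)
  qed simp_all
  have coassoc: "\<a> ?Q ?Q ?Q \<cdot> (comult Q \<otimes> \<i> ?Q) \<cdot> comult Q = (\<i> ?Q \<otimes> comult Q) \<cdot> comult Q"
  proof (rule epi1)
    have "(\<a> ?Q ?Q ?Q \<cdot> (comult Q \<otimes> \<i> ?Q) \<cdot> comult Q) \<cdot> p
        = (\<a> ?Q ?Q ?Q \<cdot> ((p \<otimes> p) \<otimes> p)) \<cdot> (comult A \<otimes> \<i> ?A) \<cdot> comult A"
      by (simp add: hc)
    also have "\<dots> = (p \<otimes> (p \<otimes> p)) \<cdot> (\<a> ?A ?A ?A \<cdot> (comult A \<otimes> \<i> ?A) \<cdot> comult A)"
      by (subst assoc_nat) simp_all
    also have "\<dots> = ((\<i> ?Q \<otimes> comult Q) \<cdot> comult Q) \<cdot> p"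
      unfolding comult_coassoc by (simp add: hc)
    finally show "(\<a> ?Q ?Q ?Q \<cdot> (comult Q \<otimes> \<i> ?Q) \<cdot> comult Q) \<cdot> p
      = ((\<i> ?Q \<otimes> comult Q) \<cdot> comult Q) \<cdot> p" .
  qed simp_all
  have counitl: "\<l> ?Q \<cdot> (counit Q \<otimes> \<i> ?Q) \<cdot> comult Q = \<i> ?Q"
  proof (rule epi1)
    have "(\<l> ?Q \<cdot> (counit Q \<otimes> \<i> ?Q) \<cdot> comult Q) \<cdot> p
        = (\<l> ?Q \<cdot> (\<i> \<one> \<otimes> p)) \<cdot> (counit A \<otimes> \<i> ?A) \<cdot> comult A"
      by (simp add: hc he)
    also have "\<dots> = p \<cdot> (\<l> ?A \<cdot> (counit A \<otimes> \<i> ?A) \<cdot> comult A)"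
      by (subst left_unitor_nat) simp_all
    finally show "(\<l> ?Q \<cdot> (counit Q \<otimes> \<i> ?Q) \<cdot> comult Q) \<cdot> p = \<i> ?Q \<cdot> p"
      by (simp add: comult_counit_left)
  qed simp_all
  have counitr: "\<r> ?Q \<cdot> (\<i> ?Q \<otimes> counit Q) \<cdot> comult Q = \<i> ?Q"
  proof (rule epi1)
    have "(\<r> ?Q \<cdot> (\<i> ?Q \<otimes> counit Q) \<cdot> comult Q) \<cdot> p
        = (\<r> ?Q \<cdot> (p \<otimes> \<i> \<one>)) \<cdot> (\<i> ?A \<otimes> counit A) \<cdot> comult A"
      by (simp add: hc he)
    also have "\<dots> = p \<cdot> (\<r> ?A \<cdot> (\<i> ?A \<otimes> counit A) \<cdot> comult A)"
      by (subst right_unitor_nat) simp_all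
    finally show "(\<r> ?Q \<cdot> (\<i> ?Q \<otimes> counit Q) \<cdot> comult Q) \<cdot> p = \<i> ?Q \<cdot> p"
      by (simp add: comult_counit_right)
  qed simp_all
  have comult_mult': "comult Q \<cdot> mult Q
      = (mult Q \<otimes> mult Q) \<cdot> middle_four \<C> ?Q ?Q ?Q ?Q \<cdot> (comult Q \<otimes> comult Q)"
  proof (rule epi2)
    have "(comult Q \<cdot> mult Q) \<cdot> ?p2 = (p \<otimes> p) \<cdot> (comult A \<cdot> mult A)"
      by (simp add: hm hc')
    also have "\<dots> = (mult Q \<otimes> mult Q) \<cdot> (((p \<otimes> p) \<otimes> (p \<otimes> p)) \<cdot> middle_four \<C> ?A ?A ?A ?A)
        \<cdot> (comult A \<otimes> comult A)"
      unfolding comult_mult by (simp add: hm)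
    also have "\<dots> = ((mult Q \<otimes> mult Q) \<cdot> middle_four \<C> ?Q ?Q ?Q ?Q \<cdot> (comult Q \<otimes> comult Q)) \<cdot> ?p2"
      using middle_four_nat[of p p p p ?Q ?Q ?Q ?Q, symmetric] by (simp add: hc)
    finally show "(comult Q \<cdot> mult Q) \<cdot> ?p2
      = ((mult Q \<otimes> mult Q) \<cdot> middle_four \<C> ?Q ?Q ?Q ?Q \<cdot> (comult Q \<otimes> comult Q)) \<cdot> ?p2" .
  qed simp_all
  have comult_unit': "comult Q \<cdot> unit Q = (unit Q \<otimes> unit Q) \<cdot> \<l>\<^sup>- \<one>"
    by (simp add: hu[symmetric] hc' comult_unit)
  have counit_mult': "counit Q \<cdot> mult Q = \<l> \<one> \<cdot> (counit Q \<otimes> counit Q)"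
    by (rule epi2) (simp_all add: hm he he' counit_mult)
  have counit_unit': "counit Q \<cdot> unit Q = \<i> \<one>"
    by (simp add: hu[symmetric] he' counit_unit)
  have comm: "mult Q \<cdot> \<s> ?Q ?Q = mult Q"
    by (rule epi2) (simp_all add: symmetry_nat hm hm' comp_tail[OF hm] mult_comm)
  have cocomm: "\<s> ?Q ?Q \<cdot> comult Q = comult Q"
    by (rule epi1) (simp_all add: hc comp_tail[OF symmetry_nat] comult_cocomm)
  show ?thesis
    by unfold_locales (fact Q assoc unitl unitr coassoc counitl counitr comult_mult' comult_unit'
      counit_mult' counit_unit' comm cocomm)+
qed

text \<open>
  The model is \<open>e(b) = \<sigma> b\<close> for an integral \<open>\<sigma>\<close> of a Hopf submonoid, and \<open>p\<close> is then the quotient by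
  that submonoid. The hypothesis on comultiplication reads
  \<open>\<sigma>\<^sub>1 b\<^sub>1 \<otimes> \<sigma> \<sigma>\<^sub>2 b\<^sub>2 = \<sigma> b\<^sub>1 \<otimes> \<sigma> b\<^sub>2\<close>. It has \<open>e\<close> in only one factor on the left, because the antipode
  of the quotient needs the first factor untouched; applying \<open>e\<close> there as well recovers
  the symmetric identity that makes \<open>p\<close> a coalgebra morphism.
\<close>

locale hopf_quotient = bicommutative_hopf_monoid \<C> B
  for \<C> :: "('o, 'm, 'e) sm_category_scheme" (structure) and B +
  fixes e p s :: 'm and Y :: 'o
  assumes e_mult: "e \<cdot> mult B = mult B \<cdot> (e \<otimes> \<i> (obj B))"
    and comult_e: "(\<i> (obj B) \<otimes> e) \<cdot> comult B \<cdot> e = (e \<otimes> e) \<cdot> comult B"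
    and counit_e: "counit B \<cdot> e = counit B"
    and p_hom: "p \<in> Hom \<C> (obj B) Y" and s_hom: "s \<in> Hom \<C> Y (obj B)" and Y_obj: "Y \<in> Obj \<C>"
    and ps: "p \<cdot> s = \<i> Y" and sp: "s \<cdot> p = e"
begin

definition quotient :: "('o, 'm) bimonoid" where
  "quotient = \<lparr>obj = Y, mult = p \<cdot> mult B \<cdot> (s \<otimes> s), unit = p \<cdot> unit B,
    comult = (p \<otimes> p) \<cdot> comult B \<cdot> s, counit = counit B \<cdot> s\<rparr>"

lemma arr [simp]: "p \<in> Arr \<C>" "Dom \<C> p = obj B" "Cod \<C> p = Y" "s \<in> Arr \<C>" "Dom \<C> s = Y" "Cod \<C> s = obj B"
  "Y \<in> Obj \<C>" "e \<in> Arr \<C>" "Dom \<C> e = obj B" "Cod \<C> e = obj B"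
  using p_hom s_hom Y_obj by (simp_all add: in_Hom sp[symmetric])

lemma e_s: "e \<cdot> s = s" and p_e: "p \<cdot> e = p"
  unfolding sp[symmetric] by (simp_all add: ps comp_tail[OF ps])

lemma e_mult_right: "mult B \<cdot> (\<i> (obj B) \<otimes> e) = e \<cdot> mult B"
proof -
  have "mult B \<cdot> (\<i> (obj B) \<otimes> e) = mult B \<cdot> (\<s> (obj B) (obj B) \<cdot> (\<i> (obj B) \<otimes> e))"
    using comp_tail[OF mult_comm, of "\<i> (obj B) \<otimes> e"] by simp
  also have "\<dots> = (mult B \<cdot> (e \<otimes> \<i> (obj B))) \<cdot> \<s> (obj B) (obj B)"
    by (simp add: symmetry_nat)
  also have "\<dots> = e \<cdot> mult B" unfolding e_mult[symmetric] by (simp add: mult_comm)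
  finally show ?thesis .
qed

lemma p_mult_e:
  assumes [simp]: "f \<in> Arr \<C>" "g \<in> Arr \<C>" "Cod \<C> f = obj B" "Cod \<C> g = obj B"
  shows "p \<cdot> mult B \<cdot> ((e \<cdot> f) \<otimes> g) = p \<cdot> mult B \<cdot> (f \<otimes> g)"
    and "p \<cdot> mult B \<cdot> (f \<otimes> (e \<cdot> g)) = p \<cdot> mult B \<cdot> (f \<otimes> g)"
  using comp_tail[OF e_mult[symmetric], of "f \<otimes> g"] comp_tail[OF e_mult_right, of "f \<otimes> g"]
  by (simp_all add: comp_tail[OF p_e])

lemma quotient_hom: "bimonoid_hom \<C> B quotient p"
proof -
  have "mult quotient \<cdot> (p \<otimes> p) = p \<cdot> mult B \<cdot> ((e \<cdot> \<i> (obj B)) \<otimes> (e \<cdot> \<i> (obj B)))"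
    by (simp add: quotient_def sp)
  also have "\<dots> = p \<cdot> mult B" by (simp only: p_mult_e arr ident_arr obj comp_arr) simp
  finally have m: "p \<cdot> mult B = mult quotient \<cdot> (p \<otimes> p)" ..
  have "comult quotient \<cdot> p = (p \<otimes> p) \<cdot> ((\<i> (obj B) \<otimes> e) \<cdot> comult B \<cdot> e)"
    by (simp add: quotient_def sp p_e)
  also have "\<dots> = (p \<otimes> p) \<cdot> comult B" unfolding comult_e by (simp add: p_e)
  finally have c: "comult quotient \<cdot> p = (p \<otimes> p) \<cdot> comult B" .
  show ?thesis using m c by (simp add: bimonoid_hom_def in_Hom) (simp add: quotient_def sp counit_e)
qed

text \<open>
  The antipode is \<open>p S s\<close>. Its defining equation reduces to \<open>p(S(e b\<^sub>1) e b\<^sub>2)\<close>; by the hypothesis on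
  comultiplication, \<open>e b\<^sub>1 \<otimes> e b\<^sub>2\<close> equals \<open>(e b)\<^sub>1 \<otimes> e (e b)\<^sub>2\<close>, and \<open>p\<close> absorbs the remaining inner \<open>e\<close>, leaving the
  antipode axiom of \<open>B\<close> at \<open>e b\<close>.
\<close>

lemma quotient_hopf: "bicommutative_hopf_monoid \<C> quotient"
proof -
  interpret Q: bicommutative_bimonoid \<C> quotient
    by (rule bicommutative_bimonoid_split_epi[OF quotient_hom, of s])
      (simp_all add: quotient_def ps in_Hom)
  have [simp]: "obj quotient = Y" by (simp add: quotient_def)
  obtain S where "S \<in> Hom \<C> (obj B) (obj B)"
    and S: "mult B \<cdot> (S \<otimes> \<i> (obj B)) \<cdot> comult B = unit B \<cdot> counit B"
    using ex_antipode by blast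
  then have [simp]: "S \<in> Arr \<C>" "Dom \<C> S = obj B" "Cod \<C> S = obj B" by (simp_all add: in_Hom)
  let ?S = "p \<cdot> S \<cdot> s"
  have "mult quotient \<cdot> (?S \<otimes> \<i> Y) \<cdot> comult quotient
      = p \<cdot> mult B \<cdot> ((e \<cdot> S \<cdot> e) \<otimes> (e \<cdot> \<i> (obj B))) \<cdot> comult B \<cdot> s"
    by (simp add: quotient_def sp comp_tail[OF sp])
  also have "\<dots> = (p \<cdot> mult B \<cdot> ((e \<cdot> S \<cdot> e) \<otimes> e)) \<cdot> comult B \<cdot> s" by simp
  also have "\<dots> = p \<cdot> mult B \<cdot> (S \<otimes> \<i> (obj B)) \<cdot> ((e \<otimes> e) \<cdot> comult B) \<cdot> s"
    by (subst p_mult_e) simp_all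
  also have "\<dots> = (p \<cdot> mult B \<cdot> (S \<otimes> (e \<cdot> \<i> (obj B)))) \<cdot> comult B \<cdot> e \<cdot> s"
    unfolding comult_e[symmetric] by simp
  also have "\<dots> = p \<cdot> (mult B \<cdot> (S \<otimes> \<i> (obj B)) \<cdot> comult B) \<cdot> s"
    by (subst p_mult_e) (simp_all add: e_s)
  also have "\<dots> = unit quotient \<cdot> counit quotient" unfolding S by (simp add: quotient_def)
  finally have left: "mult quotient \<cdot> (?S \<otimes> \<i> Y) \<cdot> comult quotient = unit quotient \<cdot> counit quotient" .
  have "mult quotient \<cdot> (\<i> Y \<otimes> ?S) \<cdot> comult quotient
      = mult quotient \<cdot> (\<s> Y Y \<cdot> (\<i> Y \<otimes> ?S)) \<cdot> comult quotient"
    using comp_tail[OF Q.mult_comm, of "(\<i> Y \<otimes> ?S) \<cdot> comult quotient"] by simp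
  also have "\<dots> = mult quotient \<cdot> (?S \<otimes> \<i> Y) \<cdot> (\<s> Y Y \<cdot> comult quotient)"
    by (subst symmetry_nat) simp_all
  also have "\<dots> = unit quotient \<cdot> counit quotient"
    using Q.comult_cocomm left by simp
  finally show ?thesis
    using left by unfold_locales (auto simp: in_Hom intro!: exI[of _ ?S])
qed

end

section \<open>Integrals on extensions\<close>

text \<open>
  A homomorphism \<open>\<iota> : A \<rightarrow> B\<close> lets \<open>A\<close> act on \<open>B\<close> by \<open>a b = \<iota>(a) b\<close>; averaging over this action is
  multiplication by \<open>\<iota> \<sigma>\<close>, the idempotent whose splitting yields the quotient of \<open>B\<close> by \<open>A\<close>.
\<close>

locale averaged_hom = bicommutative_hopf_monoid \<C> B + A: bicommutative_bimonoid \<C> A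
  for \<C> :: "('o, 'm, 'e) sm_category_scheme" (structure) and B A +
  fixes \<iota> \<sigma>
  assumes \<iota>_hom: "bimonoid_hom \<C> A B \<iota>" and integral_A: "normalized_integral \<C> A \<sigma>"
begin

abbreviation action where "action \<equiv> mult B \<cdot> (\<iota> \<otimes> \<i> (obj B))"

lemma \<iota>_arr [simp]: "\<iota> \<in> Arr \<C>" "Dom \<C> \<iota> = obj A" "Cod \<C> \<iota> = obj B"
  and \<iota>_mult: "\<iota> \<cdot> mult A = mult B \<cdot> (\<iota> \<otimes> \<iota>)" and \<iota>_unit: "\<iota> \<cdot> unit A = unit B"
  and \<iota>_comult: "comult B \<cdot> \<iota> = (\<iota> \<otimes> \<iota>) \<cdot> comult A" and \<iota>_counit: "counit B \<cdot> \<iota> = counit A"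
  using \<iota>_hom by (simp_all add: bimonoid_hom_def in_Hom)

lemma left_action_hom: "left_action \<C> A action (obj B)"
proof -
  have "action \<cdot> (mult A \<otimes> \<i> (obj B)) = (mult B \<cdot> (mult B \<otimes> \<i> (obj B))) \<cdot> ((\<iota> \<otimes> \<iota>) \<otimes> \<i> (obj B))"
    by (simp add: \<iota>_mult)
  also have "\<dots> = action \<cdot> (\<i> (obj A) \<otimes> action) \<cdot> \<a> (obj A) (obj A) (obj B)"
    unfolding mult_assoc by (simp add: assoc_nat)
  finally show ?thesis by (simp add: left_action_def in_Hom \<iota>_unit mult_unit_left)
qed

sublocale averaging \<C> A \<sigma> action "obj B"
  by unfold_locales (fact integral_A left_action_hom)+

text \<open>
  Associativity: \<open>\<sigma> (b c) = (\<sigma> b) c\<close>.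
\<close>

lemma average_mult: "average \<cdot> mult B = mult B \<cdot> (average \<otimes> \<i> (obj B))"
proof -
  let ?B = "obj B"
  have "mult B \<cdot> (average \<otimes> \<i> ?B)
      = (mult B \<cdot> (mult B \<otimes> \<i> ?B)) \<cdot> (((\<iota> \<cdot> \<sigma>) \<otimes> \<i> ?B) \<otimes> \<i> ?B) \<cdot> (\<l>\<^sup>- ?B \<otimes> \<i> ?B)"
    by (simp add: average_def)
  also have "\<dots> = mult B \<cdot> (\<i> ?B \<otimes> mult B) \<cdot> (\<a> ?B ?B ?B \<cdot> (((\<iota> \<cdot> \<sigma>) \<otimes> \<i> ?B) \<otimes> \<i> ?B)) \<cdot> (\<l>\<^sup>- ?B \<otimes> \<i> ?B)"
    unfolding mult_assoc by simp
  also have "\<dots> = mult B \<cdot> ((\<iota> \<cdot> \<sigma>) \<otimes> mult B) \<cdot> \<a> \<one> ?B ?B \<cdot> (\<a>\<^sup>- \<one> ?B ?B \<cdot> \<l>\<^sup>- (?B \<odot> ?B))"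
    by (subst assoc_nat) (simp_all add: left_unitor_inv_tensor)
  also have "\<dots> = mult B \<cdot> ((\<iota> \<cdot> \<sigma>) \<otimes> \<i> ?B) \<cdot> (\<i> \<one> \<otimes> mult B) \<cdot> \<l>\<^sup>- (?B \<odot> ?B)" by simp
  also have "\<dots> = average \<cdot> mult B"
    by (simp add: average_def left_unitor_inv_nat[of "mult B", simplified])
  finally show ?thesis ..
qed

lemma counit_average: "counit B \<cdot> average = counit B"
proof (rule average_absorbs_right)
  have "counit B \<cdot> action = (\<l> \<one> \<cdot> (\<i> \<one> \<otimes> counit B)) \<cdot> (counit A \<otimes> \<i> (obj B))"
    using comp_tail[OF counit_mult, of "\<iota> \<otimes> \<i> (obj B)"] by (simp add: \<iota>_counit)
  also have "\<dots> = counit B \<cdot> trivial" by (subst left_unitor_nat) simp_all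
  finally show "counit B \<cdot> action = counit B \<cdot> trivial" .
qed simp_all

text \<open>
  Evaluate \<open>\<sigma> (a b) = \<epsilon>(a) \<sigma> b\<close> at \<open>b = 1\<close>.
\<close>

lemma average_hom: "average \<cdot> \<iota> = average \<cdot> unit B \<cdot> counit A"
proof -
  let ?A = "obj A" and ?B = "obj B"
  have "\<iota> = (\<r> ?B \<cdot> (\<iota> \<otimes> \<i> \<one>)) \<cdot> \<r>\<^sup>- ?A" by (subst right_unitor_nat) simp_all
  also have "\<dots> = action \<cdot> (\<i> ?A \<otimes> unit B) \<cdot> \<r>\<^sup>- ?A"
    unfolding mult_unit_right[symmetric] by simp
  finally have "average \<cdot> \<iota> = average \<cdot> action \<cdot> (\<i> ?A \<otimes> unit B) \<cdot> \<r>\<^sup>- ?A" by simp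
  also have "\<dots> = average \<cdot> (\<l> ?B \<cdot> (\<i> \<one> \<otimes> unit B)) \<cdot> (counit A \<otimes> \<i> \<one>) \<cdot> \<r>\<^sup>- ?A"
    using comp_tail[OF average_coequalizes, of "(\<i> ?A \<otimes> unit B) \<cdot> \<r>\<^sup>- ?A"] by simp
  also have "\<dots> = average \<cdot> unit B \<cdot> (\<r> \<one> \<cdot> (counit A \<otimes> \<i> \<one>)) \<cdot> \<r>\<^sup>- ?A"
    by (subst left_unitor_nat) (simp_all add: unitors_agree)
  also have "\<dots> = average \<cdot> unit B \<cdot> counit A" by (subst right_unitor_nat) simp_all
  finally show ?thesis .
qed

text \<open>
  In element notation
  \<open>a\<^sub>1 b\<^sub>1 \<otimes> \<sigma> a\<^sub>2 b\<^sub>2 = a\<^sub>1 b\<^sub>1 \<otimes> \<epsilon>(a\<^sub>2) \<sigma> b\<^sub>2 = a b\<^sub>1 \<otimes> \<sigma> b\<^sub>2\<close>: averaging the second factor removes the action there,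
  and the counit axiom of \<open>A\<close> collapses what is left of \<open>\<Delta>(a)\<close>.
\<close>

lemma average_comult_action:
  "(\<i> (obj B) \<otimes> average) \<cdot> comult B \<cdot> action
    = (action \<otimes> average) \<cdot> \<a>\<^sup>- (obj A) (obj B) (obj B) \<cdot> (\<i> (obj A) \<otimes> comult B)"
proof -
  let ?A = "obj A" and ?B = "obj B"
  let ?M = "middle_four \<C>"
  have "(\<i> ?B \<otimes> average) \<cdot> comult B \<cdot> action
      = (mult B \<otimes> (average \<cdot> mult B)) \<cdot> ?M ?B ?B ?B ?B \<cdot> ((comult B \<cdot> \<iota>) \<otimes> comult B)"
    using comp_tail[OF comult_mult, of "\<iota> \<otimes> \<i> ?B"] by simp
  also have "\<dots> = (mult B \<otimes> (average \<cdot> mult B)) \<cdot> (?M ?B ?B ?B ?B \<cdot> ((\<iota> \<otimes> \<iota>) \<otimes> (\<i> ?B \<otimes> \<i> ?B)))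
      \<cdot> (comult A \<otimes> comult B)"
    unfolding \<iota>_comult by simp
  also have "\<dots> = (action \<otimes> (average \<cdot> action)) \<cdot> ?M ?A ?A ?B ?B \<cdot> (comult A \<otimes> comult B)"
    by (subst middle_four_nat) simp_all
  also have "\<dots> = (action \<otimes> (average \<cdot> \<l> ?B)) \<cdot> (((\<i> ?A \<otimes> \<i> ?B) \<otimes> (counit A \<otimes> \<i> ?B)) \<cdot> ?M ?A ?A ?B ?B)
      \<cdot> (comult A \<otimes> comult B)"
    unfolding average_coequalizes by simp
  also have "\<dots> = (action \<otimes> average) \<cdot> ((\<i> (?A \<odot> ?B) \<otimes> \<l> ?B) \<cdot> ?M ?A \<one> ?B ?B)
      \<cdot> (((\<i> ?A \<otimes> counit A) \<cdot> comult A) \<otimes> comult B)"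
    using middle_four_nat[of "\<i> ?A" "counit A" "\<i> ?B" "\<i> ?B" ?A \<one> ?B ?B, symmetric] by simp
  also have "\<dots> = (action \<otimes> average) \<cdot> \<a>\<^sup>- ?A ?B ?B
      \<cdot> ((\<r> ?A \<cdot> (\<i> ?A \<otimes> counit A) \<cdot> comult A) \<otimes> comult B)"
    unfolding middle_four_unit[OF A.obj obj obj] by simp
  finally show ?thesis unfolding A.comult_counit_right .
qed

lemma average_comult: "(\<i> (obj B) \<otimes> average) \<cdot> comult B \<cdot> average = (average \<otimes> average) \<cdot> comult B"
proof -
  let ?A = "obj A" and ?B = "obj B"
  have "(\<i> ?B \<otimes> average) \<cdot> comult B \<cdot> average
      = ((\<i> ?B \<otimes> average) \<cdot> comult B \<cdot> action) \<cdot> (\<sigma> \<otimes> \<i> ?B) \<cdot> \<l>\<^sup>- ?B"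
    by (simp add: average_def)
  also have "\<dots> = (action \<otimes> average) \<cdot> (\<a>\<^sup>- ?A ?B ?B \<cdot> (\<sigma> \<otimes> (\<i> ?B \<otimes> \<i> ?B)))
      \<cdot> (\<i> \<one> \<otimes> comult B) \<cdot> \<l>\<^sup>- ?B"
    unfolding average_comult_action by simp
  also have "\<dots> = (action \<otimes> average) \<cdot> ((\<sigma> \<otimes> \<i> ?B) \<otimes> \<i> ?B)
      \<cdot> (\<a>\<^sup>- \<one> ?B ?B \<cdot> \<l>\<^sup>- (?B \<odot> ?B)) \<cdot> comult B"
    by (subst assoc_inv_nat) (simp_all add: left_unitor_inv_nat[of "comult B", simplified])
  also have "\<dots> = (average \<otimes> average) \<cdot> comult B"
    unfolding left_unitor_inv_tensor[OF obj obj] by (simp add: average_def)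
  finally show ?thesis .
qed

text \<open>
  The homomorphism \<open>p\<close> kills \<open>\<iota>\<close> and hence factors as \<open>v \<pi>\<close>. Since \<open>b s(x) = s(p(b) x)\<close>,
  it follows that \<open>b s(v \<tau>) = s(v \<pi>(b) v \<tau>) = s(v(\<pi>(b) \<tau>)) = \<epsilon>(b) s(v \<tau>)\<close>, so the integral of the
  cokernel lifts along \<open>s v\<close>.
\<close>

lemma normalized_integral_extension:
  assumes "idempotents_split \<C>" "bicommutative_bimonoid \<C> D" "hopf_cokernel \<C> A B D \<iota> \<pi>"
    "normalized_integral \<C> D \<tau>"
  shows "\<exists>\<rho>. normalized_integral \<C> B \<rho>"
proof -
  let ?B = "obj B"
  interpret D: bicommutative_bimonoid \<C> D by fact
  obtain Y s p where "Y \<in> Obj \<C>" "s \<in> Hom \<C> Y ?B" "p \<in> Hom \<C> ?B Y" "p \<cdot> s = \<i> Y" "s \<cdot> p = average"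
    using assms(1) average_idem unfolding idempotents_split_def split_idempotent_def
    by (metis average_arr obj in_Hom)
  then interpret Q: hopf_quotient \<C> B average p s Y
    by unfold_locales (simp_all add: average_mult average_comult counit_average)
  let ?Q = "Q.quotient"
  interpret Q': bicommutative_hopf_monoid \<C> ?Q by (rule Q.quotient_hopf)
  have [simp]: "obj ?Q = Y" by (simp add: Q.quotient_def)
  have "p \<cdot> \<iota> = p \<cdot> average \<cdot> \<iota>" by (simp add: comp_tail[OF Q.p_e])
  also have "\<dots> = p \<cdot> unit B \<cdot> counit A"
    unfolding average_hom by (simp add: comp_tail[OF Q.p_e])
  finally have "p \<cdot> \<iota> = p \<cdot> trivial_hom \<C> A B" by (simp add: trivial_hom_def)
  then obtain v where "bimonoid_hom \<C> D ?Q v" and vp: "v \<cdot> \<pi> = p"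
    using assms(3) Q.quotient_hopf Q.quotient_hom unfolding hopf_cokernel_def by blast
  then have v [simp]: "v \<in> Arr \<C>" "Dom \<C> v = obj D" "Cod \<C> v = Y"
    and vm: "mult ?Q \<cdot> (v \<otimes> v) = v \<cdot> mult D" and ve: "counit ?Q \<cdot> v = counit D"
    by (simp_all add: bimonoid_hom_def in_Hom)
  have \<pi> [simp]: "\<pi> \<in> Arr \<C>" "Dom \<C> \<pi> = ?B" "Cod \<C> \<pi> = obj D" and \<pi>e: "counit D \<cdot> \<pi> = counit B"
    using assms(3) by (simp_all add: hopf_cokernel_def bimonoid_hom_def in_Hom)
  have \<tau> [simp]: "\<tau> \<in> Arr \<C>" "Dom \<C> \<tau> = \<one>" "Cod \<C> \<tau> = obj D"
    and \<tau>m: "mult D \<cdot> (\<i> (obj D) \<otimes> \<tau>) = \<tau> \<cdot> counit D \<cdot> \<r> (obj D)" and \<tau>e: "counit D \<cdot> \<tau> = \<i> \<one>"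
    using assms(4) by (simp_all add: normalized_integral_def in_Hom)
  have linear: "mult B \<cdot> (\<i> ?B \<otimes> s) = s \<cdot> mult ?Q \<cdot> (p \<otimes> \<i> Y)"
  proof -
    have "s \<cdot> mult ?Q \<cdot> (p \<otimes> \<i> Y) = (average \<cdot> mult B) \<cdot> (average \<otimes> s)"
      by (simp add: Q.quotient_def Q.sp comp_tail[OF Q.sp])
    also have "\<dots> = mult B \<cdot> (average \<otimes> \<i> ?B) \<cdot> (\<i> ?B \<otimes> s)"
      unfolding average_mult by (simp add: average_idem)
    also have "\<dots> = (mult B \<cdot> (\<i> ?B \<otimes> average)) \<cdot> (\<i> ?B \<otimes> s)"
      using comp_tail[OF average_mult[symmetric], of "\<i> ?B \<otimes> s"]
      unfolding Q.e_mult_right by simp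
    also have "\<dots> = mult B \<cdot> (\<i> ?B \<otimes> s)" by (simp add: Q.e_s)
    finally show ?thesis ..
  qed
  let ?\<rho> = "s \<cdot> v \<cdot> \<tau>"
  have "mult B \<cdot> (\<i> ?B \<otimes> ?\<rho>) = (mult B \<cdot> (\<i> ?B \<otimes> s)) \<cdot> (\<i> ?B \<otimes> (v \<cdot> \<tau>))" by simp
  also have "\<dots> = s \<cdot> (mult ?Q \<cdot> (v \<otimes> v)) \<cdot> (\<pi> \<otimes> \<tau>)"
    unfolding linear by (simp add: vp)
  also have "\<dots> = s \<cdot> v \<cdot> (mult D \<cdot> (\<i> (obj D) \<otimes> \<tau>)) \<cdot> (\<pi> \<otimes> \<i> \<one>)"
    unfolding vm by simp
  also have "\<dots> = ?\<rho> \<cdot> counit D \<cdot> (\<r> (obj D) \<cdot> (\<pi> \<otimes> \<i> \<one>))" unfolding \<tau>m by simp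
  also have "\<dots> = ?\<rho> \<cdot> counit B \<cdot> \<r> ?B"
    by (subst right_unitor_nat) (simp_all add: comp_tail[OF \<pi>e])
  finally have "mult B \<cdot> (\<i> ?B \<otimes> ?\<rho>) = ?\<rho> \<cdot> counit B \<cdot> \<r> ?B" .
  moreover have "counit B \<cdot> ?\<rho> = \<i> \<one>"
    using comp_tail[OF ve, of \<tau>] \<tau>e by (simp add: Q.quotient_def)
  ultimately show ?thesis by (auto simp: normalized_integral_def in_Hom intro!: exI[of _ ?\<rho>])
qed

end


section \<open>Duality\<close>

text \<open>
  The structure morphisms of the opposite category are the inverse ones. On parameters that are not
  objects the structure morphisms are arbitrary and need not be invertible; leaving those unchanged makes
  \<open>opposite\<close> an involution on the nose, so that a Hopf monoid in the opposite category has its dual in the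
  original category itself.
\<close>

definition formal_inverse :: "('o, 'm, 'e) category_scheme \<Rightarrow> 'm \<Rightarrow> 'm" where
  "formal_inverse \<C> f = (if iso \<C> f then inverse_arrow \<C> f else f)"

definition opposite :: "('o, 'm) sm_category \<Rightarrow> ('o, 'm) sm_category" where
  "opposite \<C> = \<lparr>Obj = Obj \<C>, Arr = Arr \<C>, Dom = Cod \<C>, Cod = Dom \<C>, ident = ident \<C>,
    comp = (\<lambda>g f. comp \<C> f g), unit_obj = unit_obj \<C>, tensor_obj = tensor_obj \<C>,
    tensor_arr = tensor_arr \<C>,
    associator = (\<lambda>X Y Z. formal_inverse \<C> (associator \<C> X Y Z)),
    left_unitor = (\<lambda>X. formal_inverse \<C> (left_unitor \<C> X)),
    right_unitor = (\<lambda>X. formal_inverse \<C> (right_unitor \<C> X)),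
    symmetry = (\<lambda>X Y. symmetry \<C> Y X)\<rparr>"

definition dual :: "('o, 'm) bimonoid \<Rightarrow> ('o, 'm) bimonoid" where
  "dual A = \<lparr>obj = obj A, mult = comult A, unit = counit A, comult = mult A, counit = unit A\<rparr>"

lemma dual_simps [simp]:
  "obj (dual A) = obj A" "mult (dual A) = comult A" "unit (dual A) = counit A"
  "comult (dual A) = mult A" "counit (dual A) = unit A" "dual (dual A) = A"
  by (simp_all add: dual_def)

lemma opposite_simps [simp]:
  "Obj (opposite \<C>) = Obj \<C>" "Arr (opposite \<C>) = Arr \<C>"
  "Dom (opposite \<C>) = Cod \<C>" "Cod (opposite \<C>) = Dom \<C>"
  "\<i>\<^bsub>opposite \<C>\<^esub> X = \<i>\<^bsub>\<C>\<^esub> X" "g \<cdot>\<^bsub>opposite \<C>\<^esub> f = f \<cdot>\<^bsub>\<C>\<^esub> g" "\<one>\<^bsub>opposite \<C>\<^esub> = \<one>\<^bsub>\<C>\<^esub>"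
  "X \<odot>\<^bsub>opposite \<C>\<^esub> Y = X \<odot>\<^bsub>\<C>\<^esub> Y" "f \<otimes>\<^bsub>opposite \<C>\<^esub> g = f \<otimes>\<^bsub>\<C>\<^esub> g"
  "\<s>\<^bsub>opposite \<C>\<^esub> X Y = \<s>\<^bsub>\<C>\<^esub> Y X"
  "Hom (opposite \<C>) X Y = Hom \<C> Y X"
  by (auto simp: opposite_def Hom_def)

lemma inverse_arrows_opposite [simp]: "inverse_arrows (opposite \<C>) f g = inverse_arrows \<C> f g"
  by (auto simp: inverse_arrows_def)

lemma iso_opposite [simp]: "iso (opposite \<C>) f = iso \<C> f"
  "inverse_arrow (opposite \<C>) f = inverse_arrow \<C> f"
  by (simp_all add: iso_def inverse_arrow_def)

lemma (in category) formal_inverse_involution [simp]: "formal_inverse \<C> (formal_inverse \<C> f) = f"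
  by (simp add: formal_inverse_def)

lemma idempotents_split_opposite: "idempotents_split \<C> \<Longrightarrow> idempotents_split (opposite \<C>)"
  unfolding idempotents_split_def split_idempotent_def by (fastforce simp: Hom_def)

locale plain_symmetric_monoidal_category = symmetric_monoidal_category \<C>
  for \<C> :: "('o, 'm) sm_category" (structure)
begin

lemma opposite_structure [simp]:
  assumes "X \<in> Obj \<C>"
  shows "\<l>\<^bsub>opposite \<C>\<^esub> X = \<l>\<^sup>- X" "\<r>\<^bsub>opposite \<C>\<^esub> X = \<r>\<^sup>- X"
    "\<lbrakk>Y \<in> Obj \<C>; Z \<in> Obj \<C>\<rbrakk> \<Longrightarrow> \<a>\<^bsub>opposite \<C>\<^esub> X Y Z = \<a>\<^sup>- X Y Z"
  using assms by (simp_all add: opposite_def formal_inverse_def)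

lemma opposite_opposite [simp]: "opposite (opposite \<C>) = \<C>"
proof -
  have "formal_inverse (opposite \<C>) = formal_inverse \<C>" by (simp add: fun_eq_iff formal_inverse_def)
  then show ?thesis by (simp add: opposite_def[of "opposite \<C>"]) (simp add: opposite_def)
qed

lemma symmetric_monoidal_category_opposite: "symmetric_monoidal_category (opposite \<C>)"
proof
  fix W X Y Z
  assume [simp]: "W \<in> Obj (opposite \<C>)" "X \<in> Obj (opposite \<C>)" "Y \<in> Obj (opposite \<C>)" "Z \<in> Obj (opposite \<C>)"
  then have [simp]: "W \<in> Obj \<C>" "X \<in> Obj \<C>" "Y \<in> Obj \<C>" "Z \<in> Obj \<C>" by simp_all
  show "(\<i>\<^bsub>opposite \<C>\<^esub> W \<otimes>\<^bsub>opposite \<C>\<^esub> \<a>\<^bsub>opposite \<C>\<^esub> X Y Z) \<cdot>\<^bsub>opposite \<C>\<^esub>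
      \<a>\<^bsub>opposite \<C>\<^esub> W (X \<odot>\<^bsub>opposite \<C>\<^esub> Y) Z \<cdot>\<^bsub>opposite \<C>\<^esub>
      (\<a>\<^bsub>opposite \<C>\<^esub> W X Y \<otimes>\<^bsub>opposite \<C>\<^esub> \<i>\<^bsub>opposite \<C>\<^esub> Z) =
      \<a>\<^bsub>opposite \<C>\<^esub> W X (Y \<odot>\<^bsub>opposite \<C>\<^esub> Z) \<cdot>\<^bsub>opposite \<C>\<^esub>
      \<a>\<^bsub>opposite \<C>\<^esub> (W \<odot>\<^bsub>opposite \<C>\<^esub> X) Y Z"
    using arg_cong[OF pentagon[of W X Y Z], of "inverse_arrow \<C>"] by simp
  show "(\<i>\<^bsub>opposite \<C>\<^esub> X \<otimes>\<^bsub>opposite \<C>\<^esub> \<l>\<^bsub>opposite \<C>\<^esub> Y) \<cdot>\<^bsub>opposite \<C>\<^esub>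
      \<a>\<^bsub>opposite \<C>\<^esub> X \<one>\<^bsub>opposite \<C>\<^esub> Y = \<r>\<^bsub>opposite \<C>\<^esub> X \<otimes>\<^bsub>opposite \<C>\<^esub> \<i>\<^bsub>opposite \<C>\<^esub> Y"
    using arg_cong[OF triangle[of X Y], of "inverse_arrow \<C>"] by simp
  show "\<a>\<^bsub>opposite \<C>\<^esub> Y Z X \<cdot>\<^bsub>opposite \<C>\<^esub> \<s>\<^bsub>opposite \<C>\<^esub> X (Y \<odot>\<^bsub>opposite \<C>\<^esub> Z) \<cdot>\<^bsub>opposite \<C>\<^esub>
      \<a>\<^bsub>opposite \<C>\<^esub> X Y Z =
      (\<i>\<^bsub>opposite \<C>\<^esub> Y \<otimes>\<^bsub>opposite \<C>\<^esub> \<s>\<^bsub>opposite \<C>\<^esub> X Z) \<cdot>\<^bsub>opposite \<C>\<^esub>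
      \<a>\<^bsub>opposite \<C>\<^esub> Y X Z \<cdot>\<^bsub>opposite \<C>\<^esub> (\<s>\<^bsub>opposite \<C>\<^esub> X Y \<otimes>\<^bsub>opposite \<C>\<^esub> \<i>\<^bsub>opposite \<C>\<^esub> Z)"
    using arg_cong[OF hexagon[of X Y Z], of "inverse_arrow \<C>"] by simp
qed (auto simp: in_Hom symmetry_inverse left_unitor_inv_nat right_unitor_inv_nat assoc_inv_nat symmetry_nat)

lemma opposite_plain: "plain_symmetric_monoidal_category (opposite \<C>)"
  by (simp add: plain_symmetric_monoidal_category_def symmetric_monoidal_category_opposite)

text \<open>
  The inverse of a middle-four interchange is the one with the middle factors swapped.
\<close>

lemma middle_four_opposite:
  assumes "W \<in> Obj \<C>" "X \<in> Obj \<C>" "Y \<in> Obj \<C>" "Z \<in> Obj \<C>"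
  shows "middle_four (opposite \<C>) W X Y Z = middle_four \<C> W Y X Z"
  using assms by (simp add: middle_four_def)

lemma bicommutative_hopf_monoid_dual:
  assumes "bicommutative_hopf_monoid \<C> A"
  shows "bicommutative_hopf_monoid (opposite \<C>) (dual A)"
proof -
  interpret bicommutative_hopf_monoid \<C> A by fact
  interpret op: symmetric_monoidal_category "opposite \<C>" by (rule symmetric_monoidal_category_opposite)
  let ?A = "obj A"
  have assoc: "\<a>\<^sup>- ?A ?A ?A \<cdot> (\<i> ?A \<otimes> comult A) \<cdot> comult A = (comult A \<otimes> \<i> ?A) \<cdot> comult A"
    unfolding comult_coassoc[symmetric] by simp
  have coassoc: "(mult A \<cdot> (mult A \<otimes> \<i> ?A)) \<cdot> \<a>\<^sup>- ?A ?A ?A = mult A \<cdot> (\<i> ?A \<otimes> mult A)"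
    unfolding mult_assoc by simp
  have unit: "(counit A \<otimes> \<i> ?A) \<cdot> comult A = \<l>\<^sup>- ?A" "(\<i> ?A \<otimes> counit A) \<cdot> comult A = \<r>\<^sup>- ?A"
    using arg_cong[OF comult_counit_left, of "\<lambda>f. \<l>\<^sup>- ?A \<cdot> f"]
      arg_cong[OF comult_counit_right, of "\<lambda>f. \<r>\<^sup>- ?A \<cdot> f"] by simp_all
  obtain S where "S \<in> Hom \<C> ?A ?A"
    "mult A \<cdot> (S \<otimes> \<i> ?A) \<cdot> comult A = unit A \<cdot> counit A"
    "mult A \<cdot> (\<i> ?A \<otimes> S) \<cdot> comult A = unit A \<cdot> counit A"
    using ex_antipode by blast
  then have antipode: "\<exists>S. S \<in> Hom \<C> ?A ?A \<and> (mult A \<cdot> (S \<otimes> \<i> ?A)) \<cdot> comult A = unit A \<cdot> counit A \<and>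
      (mult A \<cdot> (\<i> ?A \<otimes> S)) \<cdot> comult A = unit A \<cdot> counit A"
    by (auto simp: in_Hom intro!: exI[of _ S])
  show ?thesis
    using assoc coassoc unit antipode
    by unfold_locales
      (simp_all add: in_Hom middle_four_opposite mult_unit_left mult_unit_right comult_mult comult_unit
        counit_mult counit_unit mult_comm comult_cocomm)
qed

lemma bimonoid_hom_dual: "bimonoid_hom (opposite \<C>) (dual B) (dual A) f \<longleftrightarrow> bimonoid_hom \<C> A B f"
  by (auto simp: bimonoid_hom_def)

text \<open>
  The test objects of the cokernel are Hopf monoids in the opposite category. Dualizing twice returns
  them to the original category, where the kernel property applies.
\<close>

lemma hopf_cokernel_dual:
  assumes "hopf_kernel \<C> A B C \<iota> \<pi>"
  shows "hopf_cokernel (opposite \<C>) (dual C) (dual B) (dual A) \<pi> \<iota>"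
proof -
  interpret op: plain_symmetric_monoidal_category "opposite \<C>" by (rule opposite_plain)
  have "\<exists>!u. bimonoid_hom (opposite \<C>) (dual A) D u \<and> u \<cdot>\<^bsub>opposite \<C>\<^esub> \<iota> = f"
    if D: "bicommutative_hopf_monoid (opposite \<C>) D" "bimonoid_hom (opposite \<C>) (dual B) D f"
      "f \<cdot>\<^bsub>opposite \<C>\<^esub> \<pi> = f \<cdot>\<^bsub>opposite \<C>\<^esub> trivial_hom (opposite \<C>) (dual C) (dual B)" for D f
  proof -
    have "bicommutative_hopf_monoid \<C> (dual D)"
      using op.bicommutative_hopf_monoid_dual[OF D(1)] by simp
    then show ?thesis
      using assms D(2,3) bimonoid_hom_dual[of B "dual D"] bimonoid_hom_dual[of A "dual D"]
      by (simp add: hopf_kernel_def trivial_hom_def)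
  qed
  then show ?thesis using assms by (simp add: hopf_kernel_def hopf_cokernel_def bimonoid_hom_dual trivial_hom_def)
qed

text \<open>
  Coactions, cofixing morphisms and their universal objects are by definition the dual notions; only
  the coassociativity and counit equations need an inverse structure isomorphism moved to the other side.
\<close>

lemma cosmall_iff_small_dual:
  assumes "bimonoid \<C> A"
  shows "cosmall \<C> A \<longleftrightarrow> small (opposite \<C>) (dual A)"
proof -
  interpret bimonoid \<C> A by fact
  have inv: "f = inverse_arrow \<C> u \<cdot> g \<longleftrightarrow> u \<cdot> f = g"
    if "iso \<C> u" "f \<in> Arr \<C>" "g \<in> Arr \<C>" "Cod \<C> f = Dom \<C> u" "Cod \<C> g = Cod \<C> u" for u f g
    using that by auto
  have la: "left_action (opposite \<C>) (dual A) \<beta> Y \<longleftrightarrow> left_coaction \<C> A \<beta> Y" for \<beta> Y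
    using inv[of "\<a> (obj A) (obj A) Y" "(comult A \<otimes> \<i> Y) \<cdot> \<beta>" "(\<i> (obj A) \<otimes> \<beta>) \<cdot> \<beta>"]
      inv[of "\<l> Y" "(counit A \<otimes> \<i> Y) \<cdot> \<beta>" "\<i> Y"]
    by (cases "Y \<in> Obj \<C> \<and> \<beta> \<in> Hom \<C> Y (obj A \<odot> Y)") (auto simp: left_action_def left_coaction_def in_Hom)
  have ra: "right_action (opposite \<C>) (dual A) \<beta> Y \<longleftrightarrow> right_coaction \<C> A \<beta> Y" for \<beta> Y
    using inv[of "\<a> Y (obj A) (obj A)" "(\<beta> \<otimes> \<i> (obj A)) \<cdot> \<beta>" "(\<i> Y \<otimes> comult A) \<cdot> \<beta>"]
      inv[of "\<r> Y" "(\<i> Y \<otimes> counit A) \<cdot> \<beta>" "\<i> Y"]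
    by (cases "Y \<in> Obj \<C> \<and> \<beta> \<in> Hom \<C> Y (Y \<odot> obj A)") (auto simp: right_action_def right_coaction_def in_Hom)
  have l: "left_stabilized (opposite \<C>) (dual A) \<beta> Y = left_costabilized \<C> A \<beta> Y"
      "left_invariant (opposite \<C>) (dual A) \<beta> Y = left_coinvariant \<C> A \<beta> Y" if "Y \<in> Obj \<C>" for \<beta> Y
    using that by (auto simp: left_stabilized_def left_costabilized_def coequalizer_def equalizer_def
      left_fixes_def left_cofixes_def left_invariant_def left_coinvariant_def fun_eq_iff)
  have r: "right_stabilized (opposite \<C>) (dual A) \<beta> Y = right_costabilized \<C> A \<beta> Y"
      "right_invariant (opposite \<C>) (dual A) \<beta> Y = right_coinvariant \<C> A \<beta> Y" if "Y \<in> Obj \<C>" for \<beta> Y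
    using that by (auto simp: right_stabilized_def right_costabilized_def coequalizer_def equalizer_def
      right_fixes_def right_cofixes_def right_invariant_def right_coinvariant_def fun_eq_iff)
  show ?thesis
    unfolding small_def cosmall_def la ra
    using l r by (auto simp: left_coaction_def right_coaction_def)
qed

end

section \<open>Extensions of bismall Hopf monoids\<close>

lemma (in symmetric_monoidal_category) small_extension:
  assumes "idempotents_split \<C>" "bicommutative_hopf_monoid \<C> A" "bicommutative_hopf_monoid \<C> B"
    "bicommutative_hopf_monoid \<C> C" "bimonoid_hom \<C> A B \<iota>" "hopf_cokernel \<C> A B C \<iota> \<pi>"
    "small \<C> A" "small \<C> C"
  shows "small \<C> B"
proof -
  interpret A: bicommutative_hopf_monoid \<C> A by fact
  interpret B: bicommutative_hopf_monoid \<C> B by fact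
  interpret C: bicommutative_hopf_monoid \<C> C by fact
  obtain \<sigma> \<tau> where \<sigma>: "normalized_integral \<C> A \<sigma>" and \<tau>: "normalized_integral \<C> C \<tau>"
    using A.normalized_integral_if_small C.normalized_integral_if_small assms(7,8) by blast
  interpret averaged_hom \<C> B A \<iota> \<sigma> by unfold_locales (fact assms(5), fact \<sigma>)
  show ?thesis
    using normalized_integral_extension[OF assms(1) C.bicommutative_bimonoid_axioms assms(6) \<tau>]
      B.small_if_normalized_integral[OF assms(1)] by blast
qed

theorem theorem13p8:
  fixes \<C> :: "('o, 'm) sm_category"
    and A B C :: "('o, 'm) bimonoid"
  assumes "symmetric_monoidal_category \<C>"
    and "idempotents_split \<C>"
    and "bicommutative_hopf_monoid \<C> A" and "bismall \<C> A"
    and "bicommutative_hopf_monoid \<C> C" and "bismall \<C> C"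
    and "bicommutative_bimonoid \<C> B"
    and "\<exists>\<iota> \<pi>. short_exact \<C> A B C \<iota> \<pi>"
  shows "bismall \<C> B"
proof -
  interpret plain_symmetric_monoidal_category \<C>
    using assms(1) by (simp add: plain_symmetric_monoidal_category_def)
  interpret op: symmetric_monoidal_category "opposite \<C>" by (rule symmetric_monoidal_category_opposite)
  obtain \<iota> \<pi> where B: "bicommutative_hopf_monoid \<C> B"
    and hom: "bimonoid_hom \<C> A B \<iota>" "bimonoid_hom \<C> B C \<pi>"
    and ker: "hopf_kernel \<C> A B C \<iota> \<pi>" and cok: "hopf_cokernel \<C> A B C \<iota> \<pi>"
    using assms(8) unfolding short_exact_def by blast
  interpret A: bicommutative_hopf_monoid \<C> A by fact
  interpret B: bicommutative_hopf_monoid \<C> B by (fact B)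
  interpret C: bicommutative_hopf_monoid \<C> C by fact
  have "small \<C> B"
    using small_extension[OF assms(2,3) B assms(5) hom(1) cok] assms(4,6) by (simp add: bismall_def)
  moreover have "small (opposite \<C>) (dual B)"
  proof (rule op.small_extension)
    show "small (opposite \<C>) (dual C)" "small (opposite \<C>) (dual A)"
      using assms(4,6) by (simp_all add: bismall_def cosmall_iff_small_dual A.bimonoid_axioms C.bimonoid_axioms)
    show "bimonoid_hom (opposite \<C>) (dual C) (dual B) \<pi>"
      using hom(2) by (simp add: bimonoid_hom_dual)
  qed (fact idempotents_split_opposite[OF assms(2)] hopf_cokernel_dual[OF ker]
      bicommutative_hopf_monoid_dual[OF assms(3)] bicommutative_hopf_monoid_dual[OF B]
      bicommutative_hopf_monoid_dual[OF assms(5)])+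
  ultimately show ?thesis by (simp add: bismall_def cosmall_iff_small_dual[OF B.bimonoid_axioms])
qed

end
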